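(* Let $\mu=1_{|x|=1}$ on $\mathbb{Z}^2$ (that is, $\mu(x)=1$ if $|x|=1$ and $\mu(x)=0$ otherwise), and let $a_\mu$ be its potential kernel. The function $w=\dfrac{\Delta_\mu a_\mu^{1/2}}{a_\mu^{1/2}}$ on $\mathbb{Z}^2\setminus\{0\}$ is a null-critical Hardy weight on $\mathbb{Z}^2\setminus\{0\}$ and satisfies $$w(x)=\frac14\,\frac{1}{|x|^2(\log|x|)^2}-\frac{\log 8+2\gamma}{4}\,\frac{1}{|x|^2(\log|x|)^3}+\mathcal{O}\left(\frac{1}{|x|^2(\log|x|)^4}\right)$$ as $|x|\to\infty$, where $\gamma>0$ is the Euler constant.
   Context: $|\cdot|$ is the Euclidean norm. For $f\colon\mathbb{Z}^2\to\mathbb{R}$, $\Delta_\mu f(x)=\sum_{y\in\mathbb{Z}^2,\,|x-y|=1}(f(x)-f(y))$ is the standard Laplacian. For finitely supported $\varphi\colon\mathbb{Z}^2\to\mathbb{R}$, $\mathcal{Q}(\varphi)=\frac12\sum_{x,y\in\mathbb{Z}^2,\,|x-y|=1}(\varphi(x)-\varphi(y))^2$. Potential kernel: with $\mu_0=\mu/4$ and $\widehat{\mu}_0(\xi)=\sum_x\mu_0(x)e^{-i\langle x,\xi\rangle}$, $$a_\mu(x)=\frac{1}{(2\pi)^2}\int_{[-\pi,\pi]^2}\frac{1-e^{-i\langle x,\xi\rangle}}{1-\widehat{\mu}_0(\xi)}\,d\xi,\qquad x\in\mathbb{Z}^2,$$ which takes values in $[0,\infty)$. Hardy weights: for $Y\subseteq\mathbb{Z}^2$,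 a non-trivial function $w\colon Y\to[0,\infty)$ is a Hardy weight on $Y$ if $\mathcal{Q}(\varphi)\ge\sum_{x\in Y}w(x)\varphi(x)^2$ for all finitely supported $\varphi$ vanishing outside $Y$. A Hardy weight $w$ on $Y$ is critical if every Hardy weight $w'\ge w$ on $Y$ satisfies $w'=w$. In this case there is a unique (up to scalar multiples) function $u$ positive on $Y$, vanishing outside $Y$, with $\Delta_\mu u=wu$ on $Y$, called the (Agmon) ground state. A critical Hardy weight is null-critical if $\sum_{x\in Y}w(x)u(x)^2=\infty$ for its ground state $u$. *)

theory Defs
  imports "HOL-Analysis.Analysis" "HOL-Library.Landau_Symbols"
begin

type_synonym lattice = "int \<times> int"

definition real_point :: "lattice \<Rightarrow> real \<times> real" where
  "real_point x = (real_of_int (fst x), real_of_int (snd x))"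

definition enorm :: "lattice \<Rightarrow> real" where
  "enorm x = norm (real_point x)"

definition mu :: "lattice \<Rightarrow> real" where
  "mu x = (if enorm x = 1 then 1 else 0)"

definition mu0 :: "lattice \<Rightarrow> real" where
  "mu0 x = mu x / 4"

definition laplacian :: "(lattice \<Rightarrow> real) \<Rightarrow> lattice \<Rightarrow> real" where
  "laplacian f x = (\<Sum>y | enorm (x - y) = 1. f x - f y)"

text \<open>The sums over ordered pairs below and in \<open>hardy_weight\<close> have only finitely many
  nonzero terms, since they are only used for finitely supported functions.\<close>

definition quad_form :: "(lattice \<Rightarrow> real) \<Rightarrow> real" where
  "quad_form \<phi> =
     1/2 * (\<Sum>\<^sub>\<infinity>(x, y) \<in> {(x, y). enorm (x - y) = 1}. (\<phi> x - \<phi> y)\<^sup>2)"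

definition mu0_hat :: "real \<times> real \<Rightarrow> complex" where
  "mu0_hat \<xi> =
     (\<Sum>\<^sub>\<infinity>x. complex_of_real (mu0 x) * exp (- \<i> * complex_of_real (real_point x \<bullet> \<xi>)))"

text \<open>The integrand is absolutely integrable: \<open>1 - mu0_hat \<xi>\<close> vanishes on the square
  only at \<open>\<xi> = 0\<close>, near which the quotient is at most of order \<open>1 / norm \<xi>\<close>.
  The integral is real because the imaginary part of the integrand is odd in \<open>\<xi>\<close>,
  so \<open>Re\<close> only adjusts the type.\<close>

definition potential_kernel :: "lattice \<Rightarrow> real" where
  "potential_kernel x =
     Re (1 / (2 * complex_of_real pi)\<^sup>2 *
         (LINT \<xi> : {-pi..pi} \<times> {-pi..pi} | lborel.
            (1 - exp (- \<i> * complex_of_real (real_point x \<bullet> \<xi>))) / (1 - mu0_hat \<xi>)))"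

text \<open>A function on \<open>Y\<close> is represented by a total function of which only the values on
  \<open>Y\<close> matter.\<close>

definition hardy_weight :: "lattice set \<Rightarrow> (lattice \<Rightarrow> real) \<Rightarrow> bool" where
  "hardy_weight Y w \<longleftrightarrow>
     (\<forall>x\<in>Y. 0 \<le> w x) \<and> (\<exists>x\<in>Y. w x \<noteq> 0) \<and>
     (\<forall>\<phi>. finite {x. \<phi> x \<noteq> 0} \<and> (\<forall>x. x \<notin> Y \<longrightarrow> \<phi> x = 0) \<longrightarrow>
        quad_form \<phi> \<ge> (\<Sum>\<^sub>\<infinity>x\<in>Y. w x * (\<phi> x)\<^sup>2))"

definition critical_hardy_weight :: "lattice set \<Rightarrow> (lattice \<Rightarrow> real) \<Rightarrow> bool" where
  "critical_hardy_weight Y w \<longleftrightarrow>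
     hardy_weight Y w \<and>
     (\<forall>w'. hardy_weight Y w' \<and> (\<forall>x\<in>Y. w' x \<ge> w x) \<longrightarrow> (\<forall>x\<in>Y. w' x = w x))"

definition ground_state ::
    "lattice set \<Rightarrow> (lattice \<Rightarrow> real) \<Rightarrow> (lattice \<Rightarrow> real) \<Rightarrow> bool" where
  "ground_state Y w u \<longleftrightarrow>
     (\<forall>x\<in>Y. 0 < u x) \<and> (\<forall>x. x \<notin> Y \<longrightarrow> u x = 0) \<and>
     (\<forall>x\<in>Y. laplacian u x = w x * u x)"

text \<open>The ground state of a critical Hardy weight is unique up to a positive scalar, which does
  not affect divergence of the sum. The definition asks for existence and for divergence for
  every ground state, so it does not depend on which one is taken.\<close>

definition null_critical_hardy_weight :: "lattice set \<Rightarrow> (lattice \<Rightarrow> real) \<Rightarrow> bool" where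
  "null_critical_hardy_weight Y w \<longleftrightarrow>
     critical_hardy_weight Y w \<and>
     (\<exists>u. ground_state Y w u) \<and>
     (\<forall>u. ground_state Y w u \<longrightarrow> (\<Sum>\<^sub>\<infinity>x\<in>Y. ennreal (w x * (u x)\<^sup>2)) = \<infinity>)"

end

theory Submission
  imports Defs "HOL-Real_Asymp.Real_Asymp"
begin

text \<open>
  Write \<open>a\<close> for the potential kernel and \<open>u\<close> for its square root. The kernel vanishes at the
  origin, is positive and harmonic elsewhere, and tends to infinity. These facts alone make
  \<open>w = laplacian u / u\<close> null-critical. The ground state representation turns
  \<open>quad_form \<phi> - (\<Sum>x. w x * (\<phi> x)\<^sup>2)\<close> into a weighted Dirichlet sum of \<open>\<phi> / u\<close>, so it is
  nonnegative. For criticality one tests with \<open>u\<close> times a cutoff that falls logarithmically from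
  \<open>1\<close> to \<open>0\<close> while \<open>a\<close> grows from \<open>1\<close> to \<open>S\<close>. The flux of a harmonic function through its level
  sets is constant, so summation by parts evaluates the relevant edge sum exactly
  (\<open>cutoff_flux\<close>), and the energy of the test function is at most \<open>8 / ln S\<close>. Letting \<open>S\<close> tend to
  infinity excludes larger Hardy weights and forces every ground state to be a multiple of \<open>u\<close>.
  The same exact edge sum bounds the mass of \<open>w u\<^sup>2\<close> from below by a multiple of \<open>ln S\<close>, so this
  mass is infinite.

  For the expansion of \<open>w\<close>, expand the square root around \<open>a x\<close>. Harmonicity kills the linear
  term, and what remains is one eighth of \<open>\<Sum>y. (a y - a x)\<^sup>2 / (a x)\<^sup>2\<close> up to a cubic error. It
  is then enough to know \<open>a x = 2 / pi * (ln \<bar>x\<bar> + euler_mascheroni + ln 8 / 2)\<close> up to order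
  \<open>1 / \<bar>x\<bar>\<close> and the squared gradient \<open>8 / (pi\<^sup>2 \<bar>x\<bar>\<^sup>2)\<close> up to order \<open>1 / \<bar>x\<bar>\<^sup>3\<close>.

  Both come from a one-dimensional formula for \<open>a\<close>. Integrating out one Fourier variable gives
  \<open>a (m, n) = 2 / pi * integral {0..pi} (\<lambda>\<theta>. (1 - cos (m \<theta>) * exp (- \<bar>n\<bar> s)) / sinh s)\<close> with
  \<open>cosh s = 2 - cos \<theta>\<close>, equivalently \<open>sinh (s / 2) = sin (\<theta> / 2)\<close>
  (\<open>potential_kernel_integral\<close>). By the symmetries of the lattice it suffices to consider
  \<open>\<bar>m\<bar> \<le> n\<close>, where the factor \<open>exp (- n s)\<close> confines the integrals to \<open>\<theta>\<close> of order \<open>1 / n\<close>.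
  The four differences of \<open>a\<close> at \<open>(m, n)\<close> are combinations of only two integrals; one equals
  \<open>n / (n\<^sup>2 + m\<^sup>2)\<close> and the other \<open>0\<close>, both up to order \<open>1 / n\<^sup>2\<close>. The additive constant is
  found on the diagonal: there the integrand of the difference has an elementary antiderivative,
  which makes \<open>a (n, n)\<close> a partial sum of the odd harmonic series. Adding up horizontal
  differences carries the asymptotics from the diagonal to the whole cone.
\<close>

section \<open>Sums over nearest neighbours\<close>

definition steps :: "lattice set" where "steps = {(1,0),(-1,0),(0,1),(0,-1)}"

lemma enorm_sq: "(enorm x)\<^sup>2 = (real_of_int (fst x))\<^sup>2 + (real_of_int (snd x))\<^sup>2"
  by (simp add: enorm_def real_point_def norm_Pair)

lemma enorm_nonneg [simp]: "0 \<le> enorm x"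
  by (simp add: enorm_def)

lemma enorm_eq_1_iff: "enorm d = 1 \<longleftrightarrow> d \<in> steps"
proof -
  obtain a b :: int where d: "d = (a, b)" by (cases d)
  have "enorm d = 1 \<longleftrightarrow> (enorm d)\<^sup>2 = 1"
    using enorm_nonneg[of d] by (smt (verit) power2_eq_1_iff)
  also have "\<dots> \<longleftrightarrow> real_of_int (a\<^sup>2 + b\<^sup>2) = 1"
    unfolding enorm_sq d by simp
  also have "\<dots> \<longleftrightarrow> a\<^sup>2 + b\<^sup>2 = 1"
    by linarith
  also have "\<dots> \<longleftrightarrow> d \<in> steps"
  proof
    assume h: "a\<^sup>2 + b\<^sup>2 = 1"
    have "a\<^sup>2 \<le> 1" "b\<^sup>2 \<le> 1" using h by (smt (verit) zero_le_power2)+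
    then have "\<bar>a\<bar> \<le> 1" "\<bar>b\<bar> \<le> 1" by (simp_all add: abs_square_le_1)
    then have "a \<in> {-1,0,1}" "b \<in> {-1,0,1}" by auto
    then show "d \<in> steps" using h by (auto simp: d steps_def)
  qed (auto simp: d steps_def)
  finally show ?thesis .
qed

lemma finite_steps [simp]: "finite steps"
  by (simp add: steps_def)

lemma neighbours_eq: "{y. enorm (x - y) = 1} = (\<lambda>d. x + d) ` steps"
proof -
  have "enorm (x - y) = 1 \<longleftrightarrow> y - x \<in> steps" for y
    unfolding enorm_eq_1_iff by (cases x, cases y) (auto simp: steps_def)
  then show ?thesis by (force simp: image_iff intro!: bexI[of _ "_ - x"])
qed

lemma finite_neighbours [simp]: "finite {y. enorm (x - y) = 1}"
  by (simp add: neighbours_eq)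

lemma sum_neighbours:
  "(\<Sum>y | enorm ((m, n) - y) = 1. h y) = h (m + 1, n) + h (m - 1, n) + h (m, n + 1) + h (m, n - 1)"
  unfolding neighbours_eq
  by (subst sum.reindex) (auto simp: inj_on_def steps_def add_ac)

lemma enorm_minus_commute: "enorm (x - y) = enorm (y - x)"
  by (simp add: enorm_def real_point_def norm_Pair power2_commute)

section \<open>Edge sums and the ground state representation\<close>

definition edges :: "(lattice \<times> lattice) set" where
  "edges = {(x, y). enorm (x - y) = 1}"

text \<open>
  Edge sums of functions supported in \<open>K\<close> reduce to this finite set. It is invariant under
  reversing edges, which sums over all neighbours of points of \<open>K\<close> would not be.
\<close>

definition edges_near :: "lattice set \<Rightarrow> (lattice \<times> lattice) set" where
  "edges_near K = {(x, y) \<in> edges. x \<in> K \<or> y \<in> K}"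

lemma finite_edges_near:
  assumes "finite K"
  shows "finite (edges_near K)"
proof (rule finite_subset)
  show "edges_near K \<subseteq> (SIGMA x:K. {y. enorm (x - y) = 1}) \<union> (SIGMA x:K. {y. enorm (x - y) = 1})\<inverse>"
    using enorm_minus_commute by (auto simp: edges_near_def edges_def simp del: minus_prod_def)
  show "finite ((SIGMA x:K. {y. enorm (x - y) = 1}) \<union> (SIGMA x:K. {y. enorm (x - y) = 1})\<inverse>)"
    using assms by auto
qed

lemma infsum_edges:
  assumes "finite K" and "\<And>x y. enorm (x - y) = 1 \<Longrightarrow> x \<notin> K \<Longrightarrow> y \<notin> K \<Longrightarrow> G (x, y) = (0::real)"
  shows "(\<Sum>\<^sub>\<infinity>e\<in>edges. G e) = (\<Sum>e\<in>edges_near K. G e)"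
proof -
  have "(\<Sum>\<^sub>\<infinity>e\<in>edges. G e) = (\<Sum>\<^sub>\<infinity>e\<in>edges_near K. G e)"
    using assms(2) by (intro infsum_cong_neutral) (auto simp: edges_near_def edges_def)
  then show ?thesis using finite_edges_near[OF assms(1)] by simp
qed

lemma sum_edges_swap:
  "(\<Sum>(x, y)\<in>edges_near K. G y x) = (\<Sum>(x, y)\<in>edges_near K. G x y)"
  by (rule sum.reindex_bij_witness[of _ prod.swap prod.swap])
     (auto simp: edges_near_def edges_def enorm_minus_commute)

lemma sum_edges_at:
  fixes G :: "lattice \<Rightarrow> lattice \<Rightarrow> real"
  assumes "finite K" and "\<And>x y. x \<notin> K \<Longrightarrow> G x y = 0"
  shows "(\<Sum>(x, y)\<in>edges_near K. G x y) = (\<Sum>x\<in>K. \<Sum>y | enorm (x - y) = 1. G x y)"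
proof -
  have "(\<Sum>x\<in>K. \<Sum>y | enorm (x - y) = 1. G x y) = (\<Sum>(x, y)\<in>(SIGMA x:K. {y. enorm (x - y) = 1}). G x y)"
    using assms(1) by (intro sum.Sigma) auto
  also have "\<dots> = (\<Sum>(x, y)\<in>edges_near K. G x y)"
    using finite_edges_near[OF assms(1)] assms(2)
    by (intro sum.mono_neutral_left) (auto simp: edges_near_def edges_def)
  finally show ?thesis by simp
qed

text \<open>
  Summation by parts. Both halves of \<open>(f x - f y) * (g x - g y)\<close> contribute equally because
  \<open>edges_near K\<close> is symmetric, and each of them is a sum over \<open>K\<close> since \<open>f\<close> vanishes outside.
\<close>

lemma green_identity:
  assumes "finite K" and "\<And>x. x \<notin> K \<Longrightarrow> f x = 0"
  shows "(\<Sum>(x, y)\<in>edges_near K. (f x - f y) * (g x - g y)) = 2 * (\<Sum>x\<in>K. f x * laplacian g x)"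
proof -
  have "(\<Sum>(x, y)\<in>edges_near K. (f x - f y) * (g x - g y))
      = (\<Sum>(x, y)\<in>edges_near K. f x * (g x - g y)) + (\<Sum>(x, y)\<in>edges_near K. f y * (g y - g x))"
    by (simp add: sum.distrib[symmetric] case_prod_unfold algebra_simps)
  also have "(\<Sum>(x, y)\<in>edges_near K. f y * (g y - g x)) = (\<Sum>(x, y)\<in>edges_near K. f x * (g x - g y))"
    using sum_edges_swap[where G="\<lambda>x y. f x * (g x - g y)"] by simp
  also have "(\<Sum>(x, y)\<in>edges_near K. f x * (g x - g y)) = (\<Sum>x\<in>K. f x * laplacian g x)"
    using assms by (subst sum_edges_at) (auto simp: laplacian_def sum_distrib_left)
  finally show ?thesis by simp
qed

lemma infsum_finite_support:
  fixes f :: "'a \<Rightarrow> real"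
  assumes "finite K" "K \<subseteq> Y" "\<And>x. x \<in> Y \<Longrightarrow> x \<notin> K \<Longrightarrow> f x = 0"
  shows "(\<Sum>\<^sub>\<infinity>x\<in>Y. f x) = (\<Sum>x\<in>K. f x)"
proof -
  have "(\<Sum>\<^sub>\<infinity>x\<in>Y. f x) = (\<Sum>\<^sub>\<infinity>x\<in>K. f x)"
    using assms by (intro infsum_cong_neutral) auto
  then show ?thesis using assms by simp
qed

text \<open>
  Put \<open>\<phi> = u \<psi>\<close>. Then \<open>(\<phi> x - \<phi> y)\<^sup>2\<close> is \<open>u x * u y * (\<psi> x - \<psi> y)\<^sup>2\<close> plus
  \<open>(u x * (\<psi> x)\<^sup>2 - u y * (\<psi> y)\<^sup>2) * (u x - u y)\<close>, and by parts the second term sums to the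
  weight term because \<open>laplacian u = w u\<close>.
\<close>

lemma ground_state_representation:
  assumes u: "ground_state Y w u" and K: "finite K" "K \<subseteq> Y" and supp: "\<And>x. x \<notin> K \<Longrightarrow> \<phi> x = 0"
  shows "quad_form \<phi> - (\<Sum>\<^sub>\<infinity>x\<in>Y. w x * (\<phi> x)\<^sup>2)
    = 1/2 * (\<Sum>(x, y)\<in>edges_near K. u x * u y * (\<phi> x / u x - \<phi> y / u y)\<^sup>2)"
proof -
  define \<psi> where "\<psi> x = \<phi> x / u x" for x
  have \<phi>: "\<phi> x = u x * \<psi> x" for x
    using u K supp[of x] unfolding \<psi>_def ground_state_def by (cases "x \<in> Y") fastforce+
  have \<psi>0: "\<psi> x = 0" if "x \<notin> K" for x
    using supp[OF that] by (simp add: \<psi>_def)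
  have "quad_form \<phi> = 1/2 * (\<Sum>(x, y)\<in>edges_near K. (\<phi> x - \<phi> y)\<^sup>2)"
    unfolding quad_form_def edges_def[symmetric] using K supp by (subst infsum_edges) auto
  also have "(\<Sum>(x, y)\<in>edges_near K. (\<phi> x - \<phi> y)\<^sup>2) =
      (\<Sum>(x, y)\<in>edges_near K. u x * u y * (\<psi> x - \<psi> y)\<^sup>2)
    + (\<Sum>(x, y)\<in>edges_near K. (u x * (\<psi> x)\<^sup>2 - u y * (\<psi> y)\<^sup>2) * (u x - u y))"
    unfolding \<phi> by (simp add: sum.distrib[symmetric] case_prod_unfold algebra_simps power2_eq_square)
  also have "(\<Sum>(x, y)\<in>edges_near K. (u x * (\<psi> x)\<^sup>2 - u y * (\<psi> y)\<^sup>2) * (u x - u y))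
    = 2 * (\<Sum>x\<in>K. u x * (\<psi> x)\<^sup>2 * laplacian u x)"
    using K \<psi>0 by (intro green_identity) auto
  also have "(\<Sum>x\<in>K. u x * (\<psi> x)\<^sup>2 * laplacian u x) = (\<Sum>x\<in>K. w x * (\<phi> x)\<^sup>2)"
    using u K by (intro sum.cong refl) (auto simp: ground_state_def \<phi> power2_eq_square)
  also have "\<dots> = (\<Sum>\<^sub>\<infinity>x\<in>Y. w x * (\<phi> x)\<^sup>2)"
    using K supp by (subst infsum_finite_support[of K]) auto
  finally show ?thesis by (simp add: \<psi>_def algebra_simps)
qed

section \<open>The punctured lattice is connected\<close>

text \<open>
  Rows other than the axis row avoid the origin, and so do columns other than the axis column;
  one can therefore walk from any point to \<open>(1, 0)\<close> along at most three such lines.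
\<close>

lemma constant_off_origin:
  assumes f: "\<And>x y. x \<noteq> 0 \<Longrightarrow> y \<noteq> 0 \<Longrightarrow> enorm (x - y) = 1 \<Longrightarrow> f x = f y"
    and "x \<noteq> 0"
  shows "f x = f (1, 0)"
proof -
  have row: "f (m, n) = f (1, n)" if "n \<noteq> 0" for m n
  proof (induction m rule: int_induct[where k=1])
    case (step1 i)
    then show ?case using f[of "(i + 1, n)" "(i, n)"] that
      by (simp add: enorm_eq_1_iff steps_def zero_prod_def)
  next
    case (step2 i)
    then show ?case using f[of "(i - 1, n)" "(i, n)"] that
      by (simp add: enorm_eq_1_iff steps_def zero_prod_def)
  qed simp
  have column: "f (m, n) = f (m, 0)" if "m \<noteq> 0" for m n
  proof (induction n rule: int_induct[where k=0])
    case (step1 i)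
    then show ?case using f[of "(m, i + 1)" "(m, i)"] that
      by (simp add: enorm_eq_1_iff steps_def zero_prod_def)
  next
    case (step2 i)
    then show ?case using f[of "(m, i - 1)" "(m, i)"] that
      by (simp add: enorm_eq_1_iff steps_def zero_prod_def)
  qed simp
  obtain m n where x: "x = (m, n)" by (cases x)
  show ?thesis
  proof (cases "n = 0")
    case True
    then have "m \<noteq> 0" using assms(2) x by (simp add: zero_prod_def)
    then show ?thesis using column[of m n] column[of m 1] row[of 1 m] column[of 1 1] True x by simp
  next
    case False
    then show ?thesis using row[of n m] column[of 1 n] x by simp
  qed
qed
section \<open>Logarithmic cutoffs\<close>

text \<open>
  The logarithm with its argument clamped to \<open>{1..S}\<close>. As a function of the potential kernel it is
  constant near the origin and far away, so \<open>1 - clamped_ln S / ln S\<close> is a cutoff.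
\<close>

definition clamped_ln :: "real \<Rightarrow> real \<Rightarrow> real" where
  "clamped_ln S s = ln (max 1 (min s S))"

lemma clamped_ln_mono:
  assumes "s \<le> t"
  shows "clamped_ln S s \<le> clamped_ln S t"
proof -
  have "max 1 (min s S) \<le> max 1 (min t S)" using assms by auto
  then show ?thesis by (simp add: clamped_ln_def)
qed

lemma clamped_ln_diff_le:
  assumes "0 < s" "s \<le> t"
  shows "clamped_ln S t - clamped_ln S s \<le> (t - s) / s"
proof -
  define s' t' where "s' = max 1 (min s S)" and "t' = max 1 (min t S)"
  have st: "1 \<le> s'" "s' \<le> t'" using assms by (auto simp: s'_def t'_def)
  have "clamped_ln S t - clamped_ln S s = ln (t' / s')"
    using st by (simp add: clamped_ln_def s'_def t'_def ln_div)
  also have "\<dots> \<le> t' / s' - 1"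
    using st by (intro ln_le_minus_one) auto
  also have "\<dots> = (t' - s') / s'" using st by (simp add: field_simps)
  also have "\<dots> \<le> (t - s) / s"
  proof (cases "s \<le> s'")
    case True
    have "t' - s' \<le> t - s" using assms by (auto simp: s'_def t'_def)
    then show ?thesis using True assms by (intro frac_le) auto
  next
    case False
    then have "t' = s'" using assms by (auto simp: s'_def t'_def max_def min_def split: if_splits)
    then show ?thesis using assms by simp
  qed
  finally show ?thesis .
qed

text \<open>
  The two sides of the comparison between the cutoff energy and the flux: values of the potential
  kernel at neighbouring points differ at most by a factor \<open>4\<close>, so the geometric mean of \<open>s\<close> and
  \<open>t\<close> is comparable to the smaller one, while the clamped logarithm has slope at most the
  reciprocal of the smaller one.
\<close>

lemma clamped_ln_energy_le:
  assumes "0 < s" "0 < t" "t \<le> 4 * s" "s \<le> 4 * t"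
  shows "sqrt s * sqrt t * (clamped_ln S s - clamped_ln S t)\<^sup>2
          \<le> 2 * ((s - t) * (clamped_ln S s - clamped_ln S t))"
    and "(s - t) * (clamped_ln S s - clamped_ln S t) \<le> 9 * (sqrt s - sqrt t)\<^sup>2"
proof -
  have *: "sqrt s * sqrt t * (clamped_ln S s - clamped_ln S t)\<^sup>2
            \<le> 2 * ((s - t) * (clamped_ln S s - clamped_ln S t))
        \<and> (s - t) * (clamped_ln S s - clamped_ln S t) \<le> 9 * (sqrt s - sqrt t)\<^sup>2"
    if "0 < s" "s \<le> t" "t \<le> 4 * s" for s t
  proof -
    define d where "d = clamped_ln S t - clamped_ln S s"
    have d: "0 \<le> d" "d \<le> (t - s) / s"
      using clamped_ln_mono[of s t S] clamped_ln_diff_le[of s t S] that by (auto simp: d_def)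
    have root: "sqrt t \<le> 2 * sqrt s"
      using real_sqrt_le_mono[OF that(3)] by (simp add: real_sqrt_mult)
    have "sqrt s * sqrt t * d \<le> sqrt s * (2 * sqrt s) * ((t - s) / s)"
      using d root that by (intro mult_mono) auto
    also have "\<dots> = 2 * (sqrt s)\<^sup>2 * ((t - s) / s)" by (simp add: power2_eq_square)
    also have "\<dots> = 2 * (t - s)" using that by simp
    finally have "sqrt s * sqrt t * d * d \<le> 2 * (t - s) * d"
      using d by (intro mult_right_mono) auto
    then have "sqrt s * sqrt t * d\<^sup>2 \<le> 2 * ((t - s) * d)"
      by (simp only: mult.assoc power2_eq_square)
    moreover have "(t - s) * d \<le> (t - s) * ((t - s) / s)"
      using d that by (intro mult_left_mono) auto
    moreover have "(t - s) * ((t - s) / s) \<le> 9 * (sqrt t - sqrt s)\<^sup>2"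
    proof -
      have "t - s = (sqrt t - sqrt s) * (sqrt t + sqrt s)"
        using that by (simp add: algebra_simps)
      then have "(t - s)\<^sup>2 = (sqrt t - sqrt s)\<^sup>2 * (sqrt t + sqrt s)\<^sup>2"
        by (metis power_mult_distrib)
      also have "\<dots> \<le> (sqrt t - sqrt s)\<^sup>2 * (3 * sqrt s)\<^sup>2"
        using root that by (intro mult_left_mono power_mono) auto
      also have "(3 * sqrt s)\<^sup>2 = 9 * s" using that by (simp add: power_mult_distrib)
      finally have "(t - s)\<^sup>2 / s \<le> 9 * (sqrt t - sqrt s)\<^sup>2"
        using that by (simp add: pos_divide_le_eq mult_ac)
      then show ?thesis by (simp add: power2_eq_square)
    qed
    moreover have "clamped_ln S s - clamped_ln S t = - d" "(s - t) * - d = (t - s) * d"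
      by (simp_all add: d_def algebra_simps)
    ultimately show ?thesis
      by (simp add: power2_commute[of "sqrt s"])
  qed
  show "sqrt s * sqrt t * (clamped_ln S s - clamped_ln S t)\<^sup>2
          \<le> 2 * ((s - t) * (clamped_ln S s - clamped_ln S t))"
    and "(s - t) * (clamped_ln S s - clamped_ln S t) \<le> 9 * (sqrt s - sqrt t)\<^sup>2"
    using *[of s t] *[of t s] assms minus_mult_minus[of "s - t" "clamped_ln S s - clamped_ln S t"]
    by (cases "s \<le> t"; simp add: power2_commute[of "clamped_ln S t"] power2_commute[of "sqrt t"]
          mult.commute[of "sqrt t"])+
qed

section \<open>Null-criticality of square-root weights\<close>

lemma infsum_ennreal_eq_infinity:
  fixes f :: "'a \<Rightarrow> real"
  assumes nonneg: "\<And>x. x \<in> Y \<Longrightarrow> 0 \<le> f x"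
    and unbounded: "\<And>B. \<exists>L. finite L \<and> L \<subseteq> Y \<and> B \<le> (\<Sum>x\<in>L. f x)"
  shows "(\<Sum>\<^sub>\<infinity>x\<in>Y. ennreal (f x)) = \<infinity>"
proof (rule ccontr)
  assume "(\<Sum>\<^sub>\<infinity>x\<in>Y. ennreal (f x)) \<noteq> \<infinity>"
  then obtain n where n: "(\<Sum>\<^sub>\<infinity>x\<in>Y. ennreal (f x)) < of_nat n"
    using ennreal_Ex_less_of_nat by (auto simp: less_top)
  obtain L where L: "finite L" "L \<subseteq> Y" "real n \<le> (\<Sum>x\<in>L. f x)"
    using unbounded by blast
  have "of_nat n \<le> ennreal (\<Sum>x\<in>L. f x)"
    using L(3) by (simp add: ennreal_of_nat_eq_real_of_nat ennreal_leI)
  also have "\<dots> = (\<Sum>x\<in>L. ennreal (f x))"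
    using nonneg L by (subst sum_ennreal) auto
  also have "\<dots> \<le> (\<Sum>\<^sub>\<infinity>x\<in>Y. ennreal (f x))"
    using L by (auto intro!: infsum_mono_neutral nonneg_summable_on_complete simp flip: infsum_finite)
  finally show False using n by simp
qed

text \<open>
  The properties of the potential kernel that null-criticality rests on. The value \<open>1\<close> at the
  neighbours of the origin is a normalisation; it lets the cutoffs be constant on every edge that
  meets the origin.
\<close>

locale planar_green_function =
  fixes a :: "lattice \<Rightarrow> real"
  assumes at_origin: "a 0 = 0"
    and pos: "x \<noteq> 0 \<Longrightarrow> 0 < a x"
    and at_unit: "enorm x = 1 \<Longrightarrow> a x = 1"
    and harmonic: "x \<noteq> 0 \<Longrightarrow> laplacian a x = 0"
    and finite_sublevel: "finite {x. a x < S}"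
begin

lemma nonneg: "0 \<le> a x"
  using at_origin pos[of x] by (cases "x = 0") auto

text \<open>
  A nonnegative function that is harmonic at \<open>x\<close> has mean \<open>a x\<close> over the four neighbours, so no
  single neighbour can exceed four times that mean.
\<close>

lemma harnack:
  assumes "x \<noteq> 0" "enorm (x - y) = 1"
  shows "a y \<le> 4 * a x"
proof -
  have "a y \<le> (\<Sum>y | enorm (x - y) = 1. a y)"
    using assms nonneg by (intro member_le_sum) auto
  also have "\<dots> = (\<Sum>y | enorm (x - y) = 1. a x)"
    using harmonic[OF assms(1)] by (simp add: laplacian_def sum_subtractf)
  also have "\<dots> = 4 * a x"
    by (cases x) (simp only: sum_neighbours)
  finally show ?thesis .
qed

lemma laplacian_at_origin: "laplacian a 0 = - 4"
proof -
  have "laplacian a 0 = (\<Sum>y | enorm (0 - y) = 1. - 1)"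
    unfolding laplacian_def
    by (intro sum.cong) (use enorm_minus_commute[of 0] in \<open>auto simp: at_origin at_unit\<close>)
  then show ?thesis unfolding zero_prod_def by (simp only: sum_neighbours) simp
qed

text \<open>
  The constant flux of \<open>a\<close> through its level sets, in summed form. The function
  \<open>ln S - clamped_ln S \<circ> a\<close> has finite support and \<open>laplacian a\<close> is concentrated at the origin, so
  summation by parts leaves a single term.
\<close>

lemma cutoff_flux:
  assumes "1 < S"
  shows "(\<Sum>(x, y)\<in>edges_near {x. a x < S}.
            (a x - a y) * (clamped_ln S (a x) - clamped_ln S (a y))) = 8 * ln S"
proof -
  define K where "K = {x. a x < S}"
  define f where "f x = ln S - clamped_ln S (a x)" for x
  have K: "finite K" "0 \<in> K" using finite_sublevel assms by (auto simp: K_def at_origin)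
  have "f x = 0" if "x \<notin> K" for x
    using that assms by (simp add: K_def f_def clamped_ln_def min_def)
  then have "(\<Sum>(x, y)\<in>edges_near K. (f x - f y) * (a x - a y)) = 2 * (\<Sum>x\<in>K. f x * laplacian a x)"
    using K by (intro green_identity) auto
  also have "(\<Sum>x\<in>K. f x * laplacian a x) = f 0 * laplacian a 0"
    using K harmonic by (subst sum.remove[of K 0]) (auto intro: sum.neutral)
  also have "\<dots> = - 4 * ln S"
    using assms by (simp add: f_def at_origin clamped_ln_def laplacian_at_origin)
  finally have "(\<Sum>(x, y)\<in>edges_near K. - ((f x - f y) * (a x - a y))) = 8 * ln S"
    by (simp add: sum_negf case_prod_unfold)
  moreover have "- ((f x - f y) * (a x - a y)) = (a x - a y) * (clamped_ln S (a x) - clamped_ln S (a y))" for x y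
    by (simp add: f_def algebra_simps)
  ultimately show ?thesis by (simp add: K_def)
qed

lemma flux_nonneg: "0 \<le> (a x - a y) * (clamped_ln S (a x) - clamped_ln S (a y))"
  using clamped_ln_mono[of "a x" "a y" S] clamped_ln_mono[of "a y" "a x" S]
  by (cases "a x \<le> a y") (auto intro: mult_nonneg_nonneg mult_nonpos_nonpos)

definition cutoff :: "real \<Rightarrow> lattice \<Rightarrow> real" where
  "cutoff S x = sqrt (a x) * (1 - clamped_ln S (a x) / ln S)"

lemma cutoff_eq_0:
  assumes "1 < S" "x \<notin> {x. a x < S} - {0}"
  shows "cutoff S x = 0"
  using assms at_origin by (auto simp: cutoff_def clamped_ln_def min_def)

lemma tendsto_cutoff: "((\<lambda>S. cutoff S x) \<longlongrightarrow> sqrt (a x)) at_top"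
proof -
  have "\<forall>\<^sub>F S in at_top. cutoff S x = sqrt (a x) * (1 - ln (max 1 (a x)) / ln S)"
    using eventually_ge_at_top[of "a x"]
    by eventually_elim (simp add: cutoff_def clamped_ln_def min_def)
  moreover have "((\<lambda>S. sqrt (a x) * (1 - ln (max 1 (a x)) / ln S)) \<longlongrightarrow> sqrt (a x) * (1 - 0)) at_top"
    by (intro tendsto_intros real_tendsto_divide_at_top[OF tendsto_const] ln_at_top)
  ultimately show ?thesis by (simp add: tendsto_cong)
qed

end

locale square_root_weight = planar_green_function +
  fixes w :: "lattice \<Rightarrow> real"
  assumes weight: "x \<noteq> 0 \<Longrightarrow> w x = laplacian (\<lambda>y. sqrt (a y)) x / sqrt (a x)"
begin

lemma ground_state_sqrt: "ground_state (- {0}) w (\<lambda>x. sqrt (a x))"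
  using pos weight at_origin by (force simp: ground_state_def)

text \<open>
  Subtracting half of the vanishing \<open>laplacian a x\<close> completes the square, since
  \<open>a x - sqrt (a x) * sqrt (a y)\<close> minus \<open>(a x - a y) / 2\<close> is half of
  \<open>(sqrt (a x) - sqrt (a y))\<^sup>2\<close>.
\<close>

lemma weight_square:
  assumes "x \<noteq> 0"
  shows "w x * a x = 1/2 * (\<Sum>y | enorm (x - y) = 1. (sqrt (a x) - sqrt (a y))\<^sup>2)"
proof -
  have "w x * sqrt (a x) = laplacian (\<lambda>y. sqrt (a y)) x"
    using weight[OF assms] pos[OF assms] by simp
  moreover have "w x * a x = w x * sqrt (a x) * sqrt (a x)"
    using nonneg[of x] by (simp only: mult.assoc real_sqrt_mult_self abs_of_nonneg)
  ultimately have "w x * a x = sqrt (a x) * laplacian (\<lambda>y. sqrt (a y)) x - 1/2 * laplacian a x"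
    using harmonic[OF assms] by simp
  also have "\<dots> = (\<Sum>y | enorm (x - y) = 1. 1/2 * (sqrt (a x) - sqrt (a y))\<^sup>2)"
    unfolding laplacian_def sum_distrib_left sum_subtractf[symmetric]
    by (intro sum.cong refl) (simp add: power2_eq_square algebra_simps diff_divide_distrib nonneg)
  finally show ?thesis by (simp add: sum_distrib_left)
qed

text \<open>
  In the ground state representation of \<open>cutoff S\<close> each edge term is at most \<open>2 / (ln S)\<^sup>2\<close> times
  the flux term of that edge, and the total flux is \<open>8 * ln S\<close>.
\<close>

lemma energy_cutoff_le:
  assumes "1 < S"
  shows "quad_form (cutoff S) - (\<Sum>\<^sub>\<infinity>x\<in>- {0}. w x * (cutoff S x)\<^sup>2) \<le> 8 / ln S"
proof -
  define K where "K = {x. a x < S}"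
  have K: "finite K" using finite_sublevel by (simp add: K_def)
  have S: "0 < ln S" using assms by simp
  have energy: "quad_form (cutoff S) - (\<Sum>\<^sub>\<infinity>x\<in>- {0}. w x * (cutoff S x)\<^sup>2)
      = 1/2 * (\<Sum>(x, y)\<in>edges_near (K - {0}).
          sqrt (a x) * sqrt (a y) * (cutoff S x / sqrt (a x) - cutoff S y / sqrt (a y))\<^sup>2)"
    using K cutoff_eq_0[OF assms] unfolding K_def
    by (intro ground_state_representation[OF ground_state_sqrt]) auto
  have "(\<Sum>(x, y)\<in>edges_near (K - {0}).
          sqrt (a x) * sqrt (a y) * (cutoff S x / sqrt (a x) - cutoff S y / sqrt (a y))\<^sup>2)
     \<le> (\<Sum>(x, y)\<in>edges_near (K - {0}).
          2 / (ln S)\<^sup>2 * ((a x - a y) * (clamped_ln S (a x) - clamped_ln S (a y))))"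
  proof (intro sum_mono, clarify)
    fix x y assume e: "(x, y) \<in> edges_near (K - {0})"
    show "sqrt (a x) * sqrt (a y) * (cutoff S x / sqrt (a x) - cutoff S y / sqrt (a y))\<^sup>2
      \<le> 2 / (ln S)\<^sup>2 * ((a x - a y) * (clamped_ln S (a x) - clamped_ln S (a y)))"
    proof (cases "x = 0 \<or> y = 0")
      case True
      then have "sqrt (a x) * sqrt (a y) = 0" by (auto simp: at_origin)
      then show ?thesis
        using mult_nonneg_nonneg[OF _ flux_nonneg[of x y S], of "2 / (ln S)\<^sup>2"]
        by (simp only: mult_zero_left) simp
    next
      case False
      then have xy: "0 < a x" "0 < a y" "a x \<le> 4 * a y" "a y \<le> 4 * a x"
        using pos harnack[of x y] harnack[of y x] e enorm_minus_commute[of x y]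
        by (auto simp: edges_near_def edges_def)
      have "cutoff S x / sqrt (a x) - cutoff S y / sqrt (a y)
          = (clamped_ln S (a y) - clamped_ln S (a x)) / ln S"
        using xy by (simp add: cutoff_def diff_divide_distrib)
      then have "sqrt (a x) * sqrt (a y) * (cutoff S x / sqrt (a x) - cutoff S y / sqrt (a y))\<^sup>2
        = sqrt (a x) * sqrt (a y) * (clamped_ln S (a x) - clamped_ln S (a y))\<^sup>2 / (ln S)\<^sup>2"
        by (simp add: power_divide power2_commute)
      also have "\<dots> \<le> 2 * ((a x - a y) * (clamped_ln S (a x) - clamped_ln S (a y))) / (ln S)\<^sup>2"
        using xy by (intro divide_right_mono clamped_ln_energy_le) auto
      finally show ?thesis by simp
    qed
  qed
  also have "\<dots> \<le> (\<Sum>(x, y)\<in>edges_near K.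
          2 / (ln S)\<^sup>2 * ((a x - a y) * (clamped_ln S (a x) - clamped_ln S (a y))))"
  proof (rule sum_mono2)
    show "finite (edges_near K)" by (rule finite_edges_near[OF K])
    show "edges_near (K - {0}) \<subseteq> edges_near K" unfolding edges_near_def by blast
    fix e :: "lattice \<times> lattice"
    obtain x y where e: "e = (x, y)" by (rule prod.exhaust)
    have "0 \<le> 2 / (ln S)\<^sup>2" by simp
    then show "0 \<le> (case e of (x, y) \<Rightarrow>
        2 / (ln S)\<^sup>2 * ((a x - a y) * (clamped_ln S (a x) - clamped_ln S (a y))))"
      unfolding e prod.case by (rule mult_nonneg_nonneg[OF _ flux_nonneg])
  qed
  also have "\<dots> = 2 / (ln S)\<^sup>2 * (8 * ln S)"
    using cutoff_flux[OF assms] by (simp only: K_def sum_distrib_left[symmetric] case_prod_unfold)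
  finally show ?thesis unfolding energy using S by (simp add: power2_eq_square)
qed

lemma hardy_weight: "hardy_weight (- {0}) w"
  unfolding hardy_weight_def
proof (intro conjI allI impI ballI)
  have wa: "0 \<le> w x * a x" if "x \<noteq> 0" for x
    unfolding weight_square[OF that] by (intro mult_nonneg_nonneg sum_nonneg) auto
  show "0 \<le> w x" if "x \<in> - {0}" for x
    using wa[of x] pos[of x] that by (simp add: zero_le_mult_iff)
  have unit: "enorm (1, 0) = 1" by (simp add: enorm_eq_1_iff steps_def)
  have "(sqrt (a (1, 0)) - sqrt (a 0))\<^sup>2 \<le> (\<Sum>y | enorm ((1, 0) - y) = 1. (sqrt (a (1, 0)) - sqrt (a y))\<^sup>2)"
    by (rule member_le_sum) (auto simp: unit)
  then have "0 < w (1, 0) * a (1, 0)"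
    using weight_square[of "(1, 0)"] at_unit[OF unit] at_origin by (simp add: zero_prod_def)
  then show "\<exists>x\<in>- {0}. w x \<noteq> 0"
    by (intro bexI[of _ "(1, 0)"]) (auto simp: zero_prod_def)
  fix \<phi> :: "lattice \<Rightarrow> real"
  assume \<phi>: "finite {x. \<phi> x \<noteq> 0} \<and> (\<forall>x. x \<notin> - {0} \<longrightarrow> \<phi> x = 0)"
  have "0 \<le> quad_form \<phi> - (\<Sum>\<^sub>\<infinity>x\<in>- {0}. w x * (\<phi> x)\<^sup>2)"
    using \<phi> by (subst ground_state_representation[OF ground_state_sqrt, of "{x. \<phi> x \<noteq> 0}"])
       (auto intro!: sum_nonneg mult_nonneg_nonneg simp: nonneg)
  then show "(\<Sum>\<^sub>\<infinity>x\<in>- {0}. w x * (\<phi> x)\<^sup>2) \<le> quad_form \<phi>" by simp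
qed

lemma tendsto_energy_bound: "((\<lambda>S. C / ln S) \<longlongrightarrow> 0) at_top" for C :: real
  by (intro real_tendsto_divide_at_top[OF tendsto_const] ln_at_top)

text \<open>
  If \<open>w'\<close> is a larger Hardy weight, then \<open>(w' x - w x) * (cutoff S x)\<^sup>2\<close> is at most the energy of
  \<open>cutoff S\<close>, which tends to \<open>0\<close> while \<open>cutoff S x\<close> tends to \<open>sqrt (a x)\<close>.
\<close>

lemma critical: "critical_hardy_weight (- {0}) w"
  unfolding critical_hardy_weight_def
proof (intro conjI hardy_weight allI impI ballI)
  fix w' :: "lattice \<Rightarrow> real" and x :: lattice
  assume w': "hardy_weight (- {0}) w' \<and> (\<forall>x\<in>- {0}. w x \<le> w' x)" and x: "x \<in> - {0}"
  have bound: "(w' x - w x) * (cutoff S x)\<^sup>2 \<le> 8 / ln S" if S: "1 < S" for S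
  proof -
    define K where "K = insert x ({x. a x < S} - {0})"
    have K: "finite K" "K \<subseteq> - {0}" "x \<in> K" using finite_sublevel x by (auto simp: K_def)
    have supp: "cutoff S z = 0" if "z \<notin> K" for z
      using cutoff_eq_0[OF S] that by (auto simp: K_def)
    have fin: "finite {z. cutoff S z \<noteq> 0}"
      by (rule finite_subset[OF _ K(1)]) (use supp in auto)
    have "(w' x - w x) * (cutoff S x)\<^sup>2 \<le> (\<Sum>z\<in>K. (w' z - w z) * (cutoff S z)\<^sup>2)"
      using K w' by (intro member_le_sum) (auto intro!: mult_nonneg_nonneg)
    also have "\<dots> = (\<Sum>\<^sub>\<infinity>z\<in>- {0}. w' z * (cutoff S z)\<^sup>2) - (\<Sum>\<^sub>\<infinity>z\<in>- {0}. w z * (cutoff S z)\<^sup>2)"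
      using K supp by (simp add: infsum_finite_support[of K] sum_subtractf left_diff_distrib)
    also have "\<dots> \<le> quad_form (cutoff S) - (\<Sum>\<^sub>\<infinity>z\<in>- {0}. w z * (cutoff S z)\<^sup>2)"
      using w' fin supp[of 0] K(2) unfolding hardy_weight_def by auto
    also have "\<dots> \<le> 8 / ln S" by (rule energy_cutoff_le[OF S])
    finally show ?thesis .
  qed
  have "\<forall>\<^sub>F S in at_top. (w' x - w x) * (cutoff S x)\<^sup>2 \<le> 8 / ln S"
    using eventually_gt_at_top[of 1] by eventually_elim (rule bound)
  then have "(w' x - w x) * (sqrt (a x))\<^sup>2 \<le> 0"
    by (intro tendsto_le[OF _ tendsto_energy_bound]) (auto intro!: tendsto_intros tendsto_cutoff)
  then have "w' x \<le> w x" using pos[of x] x by (simp add: mult_le_0_iff)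
  then show "w' x = w x" using w' x by force
qed

text \<open>
  Represent the vanishing energy of \<open>cutoff S\<close> with respect to \<open>v\<close> instead. Every single edge
  term tends to \<open>0\<close>, hence \<open>sqrt (a x) / v x\<close> agrees at neighbouring points.
\<close>

lemma ground_state_unique:
  assumes v: "ground_state (- {0}) w v"
  shows "\<exists>c>0. \<forall>x. x \<noteq> 0 \<longrightarrow> v x = c * sqrt (a x)"
proof -
  have vpos: "0 < v x" if "x \<noteq> 0" for x using v that unfolding ground_state_def by blast
  have v0: "v 0 = 0" using v unfolding ground_state_def by blast
  have vnn: "0 \<le> v x" for x using vpos[of x] v0 by (cases "x = 0") auto
  have step: "sqrt (a x) / v x = sqrt (a y) / v y" if "x \<noteq> 0" "y \<noteq> 0" and e: "enorm (x - y) = 1" for x y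
  proof -
    have bound: "v x * v y * (cutoff S x / v x - cutoff S y / v y)\<^sup>2 \<le> 16 / ln S" if S: "1 < S" for S
    proof -
      define K where "K = insert x ({x. a x < S} - {0})"
      have K: "finite K" "K \<subseteq> - {0}" "x \<in> K" using finite_sublevel \<open>x \<noteq> 0\<close> by (auto simp: K_def)
      have supp: "cutoff S z = 0" if "z \<notin> K" for z
        using cutoff_eq_0[OF S] that by (auto simp: K_def)
      have "(case (x, y) of (x, y) \<Rightarrow> v x * v y * (cutoff S x / v x - cutoff S y / v y)\<^sup>2)
         \<le> (\<Sum>(x, y)\<in>edges_near K. v x * v y * (cutoff S x / v x - cutoff S y / v y)\<^sup>2)"
        using K e vnn by (intro member_le_sum finite_edges_near) (auto simp: edges_near_def edges_def)
      also have "\<dots> = 2 * (quad_form (cutoff S) - (\<Sum>\<^sub>\<infinity>z\<in>- {0}. w z * (cutoff S z)\<^sup>2))"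
        using ground_state_representation[OF v K(1,2), of "cutoff S"] supp by simp
      also have "\<dots> \<le> 2 * (8 / ln S)" using energy_cutoff_le[OF S] by simp
      finally show ?thesis by simp
    qed
    have "\<forall>\<^sub>F S in at_top. v x * v y * (cutoff S x / v x - cutoff S y / v y)\<^sup>2 \<le> 16 / ln S"
      using eventually_gt_at_top[of 1] by eventually_elim (rule bound)
    then have "v x * v y * (sqrt (a x) / v x - sqrt (a y) / v y)\<^sup>2 \<le> 0"
      by (intro tendsto_le[OF _ tendsto_energy_bound])
        (auto intro!: tendsto_intros tendsto_cutoff simp: vpos less_imp_neq[symmetric] that)
    then show ?thesis using vpos[OF that(1)] vpos[OF that(2)] by (simp add: mult_le_0_iff)
  qed
  define c where "c = v (1, 0) / sqrt (a (1, 0))"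
  have nz: "(1, 0) \<noteq> (0 :: lattice)" by (simp add: zero_prod_def)
  have "v x = c * sqrt (a x)" if "x \<noteq> 0" for x
  proof -
    have "sqrt (a x) / v x = sqrt (a (1, 0)) / v (1, 0)"
      using constant_off_origin[of "\<lambda>x. sqrt (a x) / v x" x] step that by blast
    then show ?thesis using vpos[OF that] vpos[OF nz] pos[OF that] pos[OF nz]
      by (simp add: c_def field_simps)
  qed
  moreover have "0 < c" using vpos[OF nz] pos[OF nz] by (simp add: c_def)
  ultimately show ?thesis by blast
qed

text \<open>
  By completion of the square the mass \<open>w a\<close> is a sum of \<open>(sqrt (a x) - sqrt (a y))\<^sup>2\<close> over edges,
  which dominates one ninth of the flux through each edge. Edges at the origin carry no flux
  because the clamped logarithm vanishes at both ends, so nothing is lost by leaving out the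
  origin.
\<close>

lemma weight_mass_unbounded:
  assumes "1 < S"
  shows "\<exists>L. finite L \<and> L \<subseteq> - {0} \<and> 4 / 9 * ln S \<le> (\<Sum>x\<in>L. w x * a x)"
proof -
  define K where "K = {x. a x < S}"
  define G where "G x y = (a x - a y) * (clamped_ln S (a x) - clamped_ln S (a y))" for x y
  define L where "L = fst ` edges_near K - {0}"
  have K: "finite K" using finite_sublevel by (simp add: K_def)
  have L: "finite L" using finite_edges_near[OF K] by (simp add: L_def)
  have Gnn: "0 \<le> G x y" for x y using flux_nonneg by (simp add: G_def)
  have unit: "G x y = 0" if "x = 0 \<or> y = 0" "enorm (x - y) = 1" for x y
    using that at_unit[of x] at_unit[of y] enorm_minus_commute[of 0 y]
    by (auto simp: G_def at_origin clamped_ln_def)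
  have G_le: "G x y \<le> 9 * (sqrt (a x) - sqrt (a y))\<^sup>2" if "x \<noteq> 0" "enorm (x - y) = 1" for x y
  proof (cases "y = 0")
    case True
    then show ?thesis using unit[of x y] that by simp
  next
    case False
    then show ?thesis unfolding G_def
      using pos harnack[of x y] harnack[of y x] that enorm_minus_commute[of x y]
      by (intro clamped_ln_energy_le) auto
  qed
  have "8 * ln S = (\<Sum>(x, y)\<in>edges_near K. G x y)"
    using cutoff_flux[OF assms] by (simp add: G_def K_def)
  also have "\<dots> = (\<Sum>(x, y)\<in>{e \<in> edges_near K. fst e \<noteq> 0}. G x y)"
    using finite_edges_near[OF K]
    by (intro sum.mono_neutral_right)
       (auto simp: edges_near_def edges_def simp del: minus_prod_def intro!: unit)
  also have "\<dots> \<le> (\<Sum>(x, y)\<in>(SIGMA x:L. {y. enorm (x - y) = 1}). G x y)"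
    using L Gnn by (intro sum_mono2) (force simp: L_def edges_near_def edges_def)+
  also have "\<dots> = (\<Sum>x\<in>L. \<Sum>y | enorm (x - y) = 1. G x y)"
    using L by (intro sum.Sigma[symmetric]) auto
  also have "\<dots> \<le> (\<Sum>x\<in>L. \<Sum>y | enorm (x - y) = 1. 9 * (sqrt (a x) - sqrt (a y))\<^sup>2)"
    using G_le by (intro sum_mono) (auto simp: L_def)
  also have "\<dots> = (\<Sum>x\<in>L. 18 * (w x * a x))"
    by (intro sum.cong refl) (simp add: weight_square L_def sum_distrib_left[symmetric])
  finally have "8 * ln S \<le> 18 * (\<Sum>x\<in>L. w x * a x)" by (simp add: sum_distrib_left)
  then show ?thesis using L by (intro exI[of _ L]) (auto simp: L_def)
qed

theorem null_critical: "null_critical_hardy_weight (- {0}) w"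
  unfolding null_critical_hardy_weight_def
proof (intro conjI critical exI[of _ "\<lambda>x. sqrt (a x)"] ground_state_sqrt allI impI)
  fix v assume v: "ground_state (- {0}) w v"
  obtain c where c: "0 < c" "\<And>x. x \<noteq> 0 \<Longrightarrow> v x = c * sqrt (a x)"
    using ground_state_unique[OF v] by blast
  have eq: "w x * (v x)\<^sup>2 = c\<^sup>2 * (w x * a x)" if "x \<noteq> 0" for x
    using c that by (simp add: power_mult_distrib nonneg)
  show "(\<Sum>\<^sub>\<infinity>x\<in>- {0}. ennreal (w x * (v x)\<^sup>2)) = \<infinity>"
  proof (rule infsum_ennreal_eq_infinity)
    show "0 \<le> w x * (v x)\<^sup>2" if "x \<in> - {0}" for x
      using hardy_weight that by (auto simp: hardy_weight_def)
    fix B :: real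
    \<comment> \<open>The choice makes c^2 * 4/9 * ln S at least B, and the summand 1 ensures S > 1.\<close>
    define S where "S = exp (9 / 4 * (\<bar>B\<bar> / c\<^sup>2) + 1)"
    have "1 < S" unfolding S_def using c by (simp add: add_nonneg_pos)
    then obtain L where L: "finite L" "L \<subseteq> - {0}" "4 / 9 * ln S \<le> (\<Sum>x\<in>L. w x * a x)"
      using weight_mass_unbounded by blast
    have "c\<^sup>2 * (4 / 9 * ln S) = \<bar>B\<bar> + 4 / 9 * c\<^sup>2" using c by (simp add: S_def algebra_simps)
    then have "B \<le> c\<^sup>2 * (4 / 9 * ln S)" using abs_ge_self[of B] zero_le_power2[of c] by linarith
    also have "\<dots> \<le> c\<^sup>2 * (\<Sum>x\<in>L. w x * a x)" using L by (intro mult_left_mono) auto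
    also have "\<dots> = (\<Sum>x\<in>L. w x * (v x)\<^sup>2)"
      unfolding sum_distrib_left using L eq by (intro sum.cong refl) (metis ComplD singletonI subsetD)
    finally show "\<exists>L. finite L \<and> L \<subseteq> - {0} \<and> B \<le> (\<Sum>x\<in>L. w x * (v x)\<^sup>2)"
      using L by blast
  qed
qed

end

section \<open>The Poisson integral\<close>

lemma mu0_hat_eq: "mu0_hat \<xi> = of_real ((cos (fst \<xi>) + cos (snd \<xi>)) / 2)"
proof -
  let ?D = "{(1,0),(-1,0),(0,1),(0,-1)} :: lattice set"
  have unit: "enorm x = 1 \<longleftrightarrow> x \<in> ?D" for x
    using enorm_eq_1_iff[of x] by (simp add: steps_def)
  have "mu0_hat \<xi> = (\<Sum>\<^sub>\<infinity>x\<in>?D. of_real (1/4) * exp (- \<i> * complex_of_real (real_point x \<bullet> \<xi>)))"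
    unfolding mu0_hat_def
    by (intro infsum_cong_neutral) (auto simp: mu0_def mu_def unit)
  also have "\<dots> = (\<Sum>x\<in>?D. of_real (1/4) * exp (- \<i> * complex_of_real (real_point x \<bullet> \<xi>)))"
    by simp
  also have "\<dots> = of_real ((cos (fst \<xi>) + cos (snd \<xi>)) / 2)"
    by (cases \<xi>) (simp add: real_point_def cos_of_real[symmetric] cos_exp_eq field_simps)
  finally show ?thesis .
qed

text \<open>
  The integrals \<open>I n\<close> satisfy \<open>I (n + 1) + I (n - 1) = 2 * cosh s * I n\<close>, whose solutions are spanned
  by \<open>exp (n s)\<close> and \<open>exp (- n s)\<close>. They are bounded, so only the decaying solution occurs, and
  the relation between \<open>I 0\<close> and \<open>I 1\<close> fixes the factor.
\<close>

lemma poisson_integral: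
  fixes s :: real and n :: nat
  assumes s: "0 < s"
  shows "((\<lambda>t. cos (n * t) / (cosh s - cos t)) has_integral (2 * pi * exp (- (n * s)) / sinh s)) {-pi..pi}"
proof -
  define I where "I n = integral {-pi..pi} (\<lambda>t. cos (real n * t) / (cosh s - cos t))" for n
  have c1: "1 < cosh s" using s cosh_real_ge_1[of s] by (simp add: less_le)
  have den: "cosh s - cos t > 0" for t using c1 cos_le_one[of t] by linarith
  have den_nz: "cosh s - cos t \<noteq> 0" for t using den[of t] by simp
  have int: "(\<lambda>t. cos (real n * t) / (cosh s - cos t)) integrable_on {-pi..pi}" for n
    by (intro integrable_continuous_interval continuous_intros ballI den_nz)
  have int_cos: "((\<lambda>t. cos (real n * t)) has_integral (if n = 0 then 2 * pi else 0)) {-pi..pi}" for n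
  proof (cases "n = 0")
    case True
    then show ?thesis using has_integral_const_real[of "1 :: real" "-pi" pi] by (simp del: has_integral_const_real)
  next
    case False
    have "((\<lambda>t. cos (real n * t)) has_integral (sin (real n * pi) / n - sin (real n * - pi) / n)) {-pi..pi}"
      using False by (intro fundamental_theorem_of_calculus)
        (auto intro!: derivative_eq_intros simp: has_real_derivative_iff_has_vector_derivative[symmetric])
    then show ?thesis using False by simp
  qed
  have I: "((\<lambda>t. cos (real n * t) / (cosh s - cos t)) has_integral I n) {-pi..pi}" for n
    unfolding I_def by (rule integrable_integral[OF int])
  have rec: "I (Suc n) + I (n - 1) = 2 * cosh s * I n" if "n > 0" for n
  proof -
    have "I (Suc n) + I (n - 1) = integral {-pi..pi} (\<lambda>t. cos (real (Suc n) * t) / (cosh s - cos t)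
            + cos (real (n - 1) * t) / (cosh s - cos t))"
      unfolding I_def by (intro integral_add[symmetric] int)
    also have "\<dots> = integral {-pi..pi} (\<lambda>t. 2 * cosh s * (cos (real n * t) / (cosh s - cos t)) - 2 * cos (real n * t))"
    proof (intro integral_cong)
      fix t
      have "cos (real (Suc n) * t) + cos (real (n - 1) * t) = 2 * cos t * cos (real n * t)"
        using that cos_add[of "real n * t" t] cos_diff[of "real n * t" t]
        by (simp add: algebra_simps of_nat_diff)
      then have "cos (real (Suc n) * t) / (cosh s - cos t) + cos (real (n - 1) * t) / (cosh s - cos t)
        = (2 * cosh s * cos (real n * t) - 2 * cos (real n * t) * (cosh s - cos t)) / (cosh s - cos t)"
        unfolding add_divide_distrib[symmetric] by (simp add: algebra_simps)
      also have "\<dots> = 2 * cosh s * (cos (real n * t) / (cosh s - cos t)) - 2 * cos (real n * t)"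
        using den_nz[of t] by (simp add: diff_divide_distrib)
      finally show "cos (real (Suc n) * t) / (cosh s - cos t) + cos (real (n - 1) * t) / (cosh s - cos t)
        = 2 * cosh s * (cos (real n * t) / (cosh s - cos t)) - 2 * cos (real n * t)" .
    qed
    also have "\<dots> = 2 * cosh s * I n - 2 * 0"
      using that int_cos[of n] I[of n]
      by (intro integral_unique has_integral_diff has_integral_mult_right) auto
    finally show ?thesis by simp
  qed
  have rec0: "I 1 = cosh s * I 0 - 2 * pi"
  proof -
    have "I 1 = integral {-pi..pi} (\<lambda>t. cosh s * (cos (real 0 * t) / (cosh s - cos t)) - cos (real 0 * t))"
      unfolding I_def using den_nz by (intro integral_cong) (simp add: field_simps)
    also have "\<dots> = cosh s * I 0 - 2 * pi"
      using int_cos[of 0] I[of 0]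
      by (intro integral_unique has_integral_diff has_integral_mult_right) (auto simp: I_def)
    finally show ?thesis .
  qed
  define D where "D n = I (Suc n) - exp (- s) * I n" for n
  have D_Suc: "D (Suc n) = exp s * D n" for n
  proof -
    have c: "2 * cosh s = exp s + exp (- s)" by (simp add: cosh_def)
    have "I (Suc (Suc n)) + I n = (exp s + exp (- s)) * I (Suc n)"
      using rec[of "Suc n"] unfolding c by simp
    then have "D (Suc n) = exp s * I (Suc n) - (exp s * exp (- s)) * I n"
      unfolding D_def exp_minus_inverse by (simp add: distrib_right)
    then show ?thesis unfolding D_def by (simp only: right_diff_distrib mult.assoc)
  qed
  have D_pow: "D n = exp s ^ n * D 0" for n
    by (induction n) (simp_all add: D_Suc)
  define M where "M = 2 * pi / (cosh s - 1)"
  have I_bound: "\<bar>I n\<bar> \<le> M" for n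
  proof -
    have "norm (I n) \<le> 1 / (cosh s - 1) * (pi - - pi)"
      unfolding I_def
    proof (rule integral_bound)
      show "continuous_on {-pi..pi} (\<lambda>t. cos (real n * t) / (cosh s - cos t))"
        by (intro continuous_intros ballI den_nz)
      fix t
      have "\<bar>cos (real n * t)\<bar> / (cosh s - cos t) \<le> 1 / (cosh s - 1)"
        using c1 den[of t] by (intro frac_le) auto
      then show "norm (cos (real n * t) / (cosh s - cos t)) \<le> 1 / (cosh s - 1)"
        using den[of t] by simp
    qed auto
    then show ?thesis by (simp add: M_def)
  qed
  have D_bound: "\<bar>D n\<bar> \<le> 2 * M" for n
  proof -
    have "\<bar>exp (- s) * I n\<bar> \<le> 1 * M"
      unfolding abs_mult using s I_bound[of n] by (intro mult_mono) auto
    then show ?thesis using I_bound[of "Suc n"] unfolding D_def by linarith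
  qed
  \<comment> \<open>A nonzero D 0 would make D n grow like exp (n s), against the bound.\<close>
  have D0: "D 0 = 0"
  proof (rule ccontr)
    assume "D 0 \<noteq> 0"
    moreover obtain n where "2 * M / \<bar>D 0\<bar> < exp s ^ n"
      using real_arch_pow[of "exp s"] s by auto
    ultimately have "2 * M < \<bar>D n\<bar>"
      unfolding D_pow[of n] by (simp add: abs_mult pos_divide_less_eq)
    then show False using D_bound[of n] by simp
  qed
  have step: "I (Suc n) = exp (- s) * I n" for n
    using D_pow[of n] D0 by (simp add: D_def)
  have "sinh s * I 0 = 2 * pi"
  proof -
    have "exp (- s) * I 0 = cosh s * I 0 - 2 * pi" using step[of 0] rec0 by simp
    then have "(cosh s - exp (- s)) * I 0 = 2 * pi" by (simp add: left_diff_distrib)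
    then show ?thesis by (simp add: cosh_minus_sinh[symmetric])
  qed
  moreover have "0 < sinh s" using s by simp
  ultimately have "I 0 = 2 * pi / sinh s" by (simp add: field_simps)
  then have "I n = 2 * pi * exp (- (real n * s)) / sinh s" for n
    by (induction n) (simp_all add: step exp_add[symmetric] algebra_simps)
  then show ?thesis
    using int[of n] by (simp add: I_def has_integral_integrable_integral)
qed

section \<open>The decay rate\<close>

text \<open>
  The exponent \<open>s\<close> with \<open>cosh s = 2 - cos \<theta>\<close> for which \<open>(m, n) \<mapsto> exp (\<i> m \<theta> - n s)\<close> is harmonic.
  In this form it is visibly smooth at \<open>\<theta> = 0\<close>, and it is nonnegative on \<open>{0..pi}\<close>.
\<close>

definition decay :: "real \<Rightarrow> real" where
  "decay \<theta> = 2 * arsinh (sin (\<theta> / 2))"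

lemma sinh_half_decay: "sinh (decay \<theta> / 2) = sin (\<theta> / 2)"
  by (simp add: decay_def)

lemma cosh_decay: "cosh (decay \<theta>) = 2 - cos \<theta>"
proof -
  have "cosh (2 * (decay \<theta> / 2)) = 1 + 2 * (sinh (decay \<theta> / 2))\<^sup>2"
    unfolding cosh_double by (simp add: cosh_square_eq)
  also have "\<dots> = 1 + 2 * (sin (\<theta> / 2))\<^sup>2" by (simp add: sinh_half_decay)
  also have "\<dots> = 2 - cos \<theta>" using cos_double_sin[of "\<theta> / 2"] by simp
  finally show ?thesis by simp
qed

text \<open>
  A weak form of Jordan's inequality: halve the angle and use that the cosine is at least
  \<open>sqrt 2 / 2\<close> up to \<open>pi / 4\<close>.
\<close>

lemma sin_ge_half:
  assumes "0 \<le> x" "x \<le> pi / 2"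
  shows "x / 2 \<le> sin x"
proof (cases "x = 0")
  case False
  define y where "y = x / 2"
  have y: "0 < y" "y \<le> pi / 4" using assms False by (auto simp: y_def)
  have cos45: "cos (pi / 4) = sqrt 2 / 2" by (rule cos_45)
  obtain z where z: "0 < z" "z < y" "sin y - sin 0 = (y - 0) * cos z"
    using MVT2[of 0 y sin cos] y by (auto intro: DERIV_sin)
  have cz: "sqrt 2 / 2 \<le> cos z" "sqrt 2 / 2 \<le> cos y"
    unfolding cos45[symmetric] using z y pi_gt_zero by (auto intro!: cos_monotone_0_pi_le)
  have "y * (sqrt 2 / 2) \<le> sin y" using z cz y by (simp add: mult_left_mono)
  then have "y * (sqrt 2 / 2) * (sqrt 2 / 2) \<le> sin y * cos y"
    using cz y by (intro mult_mono) (auto intro!: sin_ge_zero order.trans[OF _ \<open>y * (sqrt 2 / 2) \<le> sin y\<close>])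
  then have "y * ((sqrt 2 / 2) * (sqrt 2 / 2)) \<le> sin y * cos y" by (simp only: mult.assoc)
  then have "y \<le> 2 * sin y * cos y" by simp
  then show ?thesis using sin_double[of y] by (simp add: y_def)
qed simp

lemma sin_half_ge:
  assumes "0 \<le> \<theta>" "\<theta> \<le> pi"
  shows "\<theta> / 4 \<le> sin (\<theta> / 2)"
  using sin_ge_half[of "\<theta> / 2"] assms by simp

lemma decay_ge:
  assumes "0 \<le> \<theta>" "\<theta> \<le> pi"
  shows "\<theta> / 4 \<le> decay \<theta>"
proof -
  define y where "y = sin (\<theta> / 2)"
  have y: "0 \<le> y" "y \<le> 1" "\<theta> / 4 \<le> y"
    using sin_half_ge[OF assms] assms by (auto simp: y_def)
  have "y / 2 \<le> 1 - 1 / (1 + y)" using y by (simp add: field_simps) (simp add: mult_left_le)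
  also have "\<dots> \<le> ln (1 + y)"
    using ln_le_minus_one[of "1 / (1 + y)"] y by (simp add: ln_div)
  also have "\<dots> \<le> arsinh y"
    unfolding arsinh_real_def using y by (intro ln_mono) (auto intro!: real_le_rsqrt simp: add_pos_nonneg)
  finally show ?thesis using y by (simp add: decay_def y_def)
qed

lemma decay_pos:
  assumes "0 < \<theta>" "\<theta> \<le> pi"
  shows "0 < decay \<theta>"
  using decay_ge[of \<theta>] assms by simp

text \<open>
  For fixed \<open>\<theta> \<noteq> 0\<close> the denominator is \<open>(cosh s - cos \<phi>) / 2\<close>, so the cosine part of the numerator
  gives a Poisson integral; the sine part is odd in \<open>\<phi>\<close> and integrates to \<open>0\<close>.
\<close>

lemma inner_integral:
  fixes m n :: int and \<theta> :: real
  assumes \<theta>: "\<theta> \<in> {-pi..pi}" "\<theta> \<noteq> 0"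
  shows "((\<lambda>\<phi>. (1 - cos (m * \<theta> + n * \<phi>)) / (1 - (cos \<theta> + cos \<phi>) / 2)) has_integral
           (4 * pi * ((1 - cos (m * \<theta>) * exp (- (\<bar>n\<bar> * decay \<bar>\<theta>\<bar>))) / sinh (decay \<bar>\<theta>\<bar>)))) {-pi..pi}"
proof -
  define s where "s = decay \<bar>\<theta>\<bar>"
  have s: "0 < s" unfolding s_def using \<theta> by (intro decay_pos) auto
  have c: "cosh s = 2 - cos \<theta>" by (simp add: s_def cosh_decay)
  have "1 < cosh s" using s cosh_real_ge_1[of s] by (simp add: less_le)
  then have den: "cosh s - cos \<phi> \<noteq> 0" for \<phi> using cos_le_one[of \<phi>] by linarith
  have one: "((\<lambda>\<phi>. 1 / (cosh s - cos \<phi>)) has_integral (2 * pi / sinh s)) {-pi..pi}"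
    using poisson_integral[OF s, of 0] by simp
  have "cos (real (nat \<bar>n\<bar>) * \<phi>) = cos (n * \<phi>)" for \<phi> :: real
    by (cases "0 \<le> n") (simp_all)
  then have cosine: "((\<lambda>\<phi>. cos (n * \<phi>) / (cosh s - cos \<phi>)) has_integral (2 * pi * exp (- (\<bar>n\<bar> * s)) / sinh s)) {-pi..pi}"
    using poisson_integral[OF s, of "nat \<bar>n\<bar>"] by simp
  define J where "J = integral {-pi..pi} (\<lambda>\<phi>. sin (n * \<phi>) / (cosh s - cos \<phi>))"
  have J: "((\<lambda>\<phi>. sin (n * \<phi>) / (cosh s - cos \<phi>)) has_integral J) {-pi..pi}"
    unfolding J_def using den
    by (intro integrable_integral integrable_continuous_interval continuous_intros) auto
  have "((\<lambda>\<phi>. sin (n * - \<phi>) / (cosh s - cos (- \<phi>))) has_integral J) {-pi..pi}"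
    using iffD2[OF has_integral_reflect_real J] by (simp del: has_integral_reflect_real)
  then have minus: "((\<lambda>\<phi>. sin (n * \<phi>) / (cosh s - cos \<phi>)) has_integral - J) {-pi..pi}"
    using has_integral_neg[of "\<lambda>\<phi>. sin (n * - \<phi>) / (cosh s - cos (- \<phi>))" J] by simp
  have J0: "J = 0" using has_integral_unique[OF J minus] by simp
  have "((\<lambda>\<phi>. 2 * (1 / (cosh s - cos \<phi>)) - 2 * cos (m * \<theta>) * (cos (n * \<phi>) / (cosh s - cos \<phi>))
           + 2 * sin (m * \<theta>) * (sin (n * \<phi>) / (cosh s - cos \<phi>))) has_integral
      (2 * (2 * pi / sinh s) - 2 * cos (m * \<theta>) * (2 * pi * exp (- (\<bar>n\<bar> * s)) / sinh s)
           + 2 * sin (m * \<theta>) * J)) {-pi..pi}"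
    using one cosine J by (intro has_integral_add has_integral_diff has_integral_mult_right)
  moreover have "2 * (1 / (cosh s - cos \<phi>)) - 2 * cos (m * \<theta>) * (cos (n * \<phi>) / (cosh s - cos \<phi>))
           + 2 * sin (m * \<theta>) * (sin (n * \<phi>) / (cosh s - cos \<phi>))
      = (1 - cos (m * \<theta> + n * \<phi>)) / (1 - (cos \<theta> + cos \<phi>) / 2)" for \<phi> :: real
  proof -
    have "1 - (cos \<theta> + cos \<phi>) / 2 = (cosh s - cos \<phi>) / 2" by (simp add: c field_simps)
    moreover have "2 * (1 / (cosh s - cos \<phi>)) - 2 * cos (m * \<theta>) * (cos (n * \<phi>) / (cosh s - cos \<phi>))
           + 2 * sin (m * \<theta>) * (sin (n * \<phi>) / (cosh s - cos \<phi>))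
       = 2 * (1 - cos (m * \<theta> + n * \<phi>)) / (cosh s - cos \<phi>)"
      unfolding cos_add by (simp add: diff_divide_distrib add_divide_distrib algebra_simps)
    ultimately show ?thesis by (simp only: divide_divide_eq_right mult.commute)
  qed
  moreover have "2 * (2 * pi / sinh s) - 2 * cos (m * \<theta>) * (2 * pi * exp (- (\<bar>n\<bar> * s)) / sinh s)
           + 2 * sin (m * \<theta>) * J
      = 4 * pi * ((1 - cos (m * \<theta>) * exp (- (\<bar>n\<bar> * s))) / sinh s)"
    by (simp add: J0 diff_divide_distrib right_diff_distrib)
  ultimately show ?thesis by (simp only: s_def)
qed

section \<open>Integrability of the Fourier integrand\<close>

lemma denominator_ge:
  assumes "\<xi> \<in> {-pi..pi} \<times> {-pi..pi}"
  shows "((fst \<xi>)\<^sup>2 + (snd \<xi>)\<^sup>2) / 16 \<le> 1 - (cos (fst \<xi>) + cos (snd \<xi>)) / 2"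
proof -
  have *: "t\<^sup>2 / 16 \<le> (1 - cos t) / 2" if "t \<in> {-pi..pi}" for t
  proof -
    have "(\<bar>t\<bar> / 4)\<^sup>2 \<le> (sin (\<bar>t\<bar> / 2))\<^sup>2"
      using sin_half_ge[of "\<bar>t\<bar>"] that by (intro power_mono) auto
    also have "\<dots> = (1 - cos t) / 2"
      using cos_double_sin[of "\<bar>t\<bar> / 2"] by simp
    finally show ?thesis by (simp add: power_divide)
  qed
  show ?thesis using *[of "fst \<xi>"] *[of "snd \<xi>"] assms by (auto simp: field_simps mem_Times_iff)
qed

lemma integrable_inverse_sqrt:
  "integrable lborel (\<lambda>t. indicator {-pi..pi} t * \<bar>t\<bar> powr (- (1/2)))"
proof -
  have "(\<lambda>t. t powr (- (1/2))) integrable_on {0..pi}"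
    by (intro integrable_on_powr_from_0) auto
  then have pos: "(\<lambda>t. \<bar>t\<bar> powr (- (1/2))) integrable_on {0..pi}"
    by (rule integrable_eq) auto
  then obtain i where "((\<lambda>t. \<bar>t\<bar> powr (- (1/2))) has_integral i) {0..pi}"
    by (auto simp: integrable_on_def)
  then have "((\<lambda>t. \<bar>- t\<bar> powr (- (1/2))) has_integral i) {-pi..-0}"
    using has_integral_reflect_real[of "\<lambda>t. \<bar>t\<bar> powr (- (1/2))" i pi 0] by blast
  then have "(\<lambda>t. \<bar>t\<bar> powr (- (1/2))) integrable_on {-pi..0}"
    by (auto simp: integrable_on_def)
  then have "(\<lambda>t. \<bar>t\<bar> powr (- (1/2))) integrable_on {-pi..pi}"
    using pos by (intro Henstock_Kurzweil_Integration.integrable_combine[OF _ _ _ pos]) auto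
  then have "(\<lambda>t. \<bar>t\<bar> powr (- (1/2))) absolutely_integrable_on {-pi..pi}"
    by (intro nonnegative_absolutely_integrable_1) auto
  then show ?thesis
    unfolding set_integrable_def by (subst (asm) integrable_completion) auto
qed

lemma integrable_mult_pair:
  fixes f g :: "real \<Rightarrow> real"
  assumes f: "integrable lborel f" and g: "integrable lborel g"
  shows "integrable (lborel \<Otimes>\<^sub>M lborel) (\<lambda>z. f (fst z) * g (snd z))"
proof (rule lborel_pair.Fubini_integrable)
  have [measurable]: "f \<in> borel_measurable borel" "g \<in> borel_measurable borel"
    using f g by (auto dest: borel_measurable_integrable)
  show "(\<lambda>z. f (fst z) * g (snd z)) \<in> borel_measurable (lborel \<Otimes>\<^sub>M lborel)"
    by measurable
  show "integrable lborel (\<lambda>x. LINT y|lborel. norm (f (fst (x, y)) * g (snd (x, y))))"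
    using f by (simp add: abs_mult)
  show "AE x in lborel. integrable lborel (\<lambda>y. f (fst (x, y)) * g (snd (x, y)))"
    using g by simp
qed

lemma AE_both_nonzero: "AE \<xi> in (lborel :: (real \<times> real) measure). fst \<xi> \<noteq> 0 \<and> snd \<xi> \<noteq> 0"
proof -
  have "emeasure (lborel \<Otimes>\<^sub>M lborel) ({0 :: real} \<times> (UNIV :: real set)) = 0"
       "emeasure (lborel \<Otimes>\<^sub>M lborel) ((UNIV :: real set) \<times> {0 :: real}) = 0"
    by (subst lborel.emeasure_pair_measure_Times; simp)+
  then have "{0 :: real} \<times> (UNIV :: real set) \<union> UNIV \<times> {0} \<in> null_sets (lborel \<Otimes>\<^sub>M lborel)"
    by (intro null_sets.Un null_setsI) auto
  then have "AE \<xi> in lborel \<Otimes>\<^sub>M lborel. \<xi> \<notin> {0 :: real} \<times> (UNIV :: real set) \<union> UNIV \<times> {0}"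
    by (rule AE_not_in)
  then show ?thesis unfolding lborel_prod by eventually_elim auto
qed

definition integrand :: "lattice \<Rightarrow> real \<times> real \<Rightarrow> complex" where
  "integrand x \<xi> = (1 - exp (- \<i> * complex_of_real (real_point x \<bullet> \<xi>))) / (1 - mu0_hat \<xi>)"

lemma integrand_eq:
  "integrand x \<xi> = (1 - exp (- \<i> * complex_of_real (real_point x \<bullet> \<xi>)))
      / of_real (1 - (cos (fst \<xi>) + cos (snd \<xi>)) / 2)"
  by (simp add: integrand_def mu0_hat_eq)

lemma norm_one_minus_cis_le: "norm (1 - exp (- \<i> * complex_of_real t)) \<le> \<bar>t\<bar>"
proof -
  have "norm (1 - exp (- \<i> * complex_of_real t)) = norm (exp (\<i> * complex_of_real (- t)) - 1)"
    by (simp add: norm_minus_commute)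
  also have "\<dots> = 2 * \<bar>sin (t / 2)\<bar>"
    unfolding dist_exp_i_1 by simp
  also have "\<dots> \<le> \<bar>t\<bar>"
    using abs_sin_x_le_abs_x[of "t / 2"] by simp
  finally show ?thesis .
qed

text \<open>
  Bounds the singularity \<open>1 / \<bar>\<xi>\<bar>\<close> by a product of one-dimensional integrable singularities.
\<close>

lemma sum_div_squares_le:
  fixes p q :: real
  assumes "0 < p" "0 < q"
  shows "(p + q) / (p\<^sup>2 + q\<^sup>2) \<le> p powr (- (1/2)) * q powr (- (1/2))"
proof -
  define r where "r = sqrt p * sqrt q"
  have r: "0 < r" using assms by (simp add: r_def)
  have "2 * r \<le> p + q"
    using assms arith_geo_mean_sqrt[of p q] by (simp add: r_def real_sqrt_mult)
  then have "(p + q) * (2 * r) \<le> (p + q) * (p + q)"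
    using assms by (intro mult_left_mono) auto
  also have "\<dots> \<le> 2 * (p\<^sup>2 + q\<^sup>2)"
    using sum_squares_ge_zero[of "p - q" 0] by (simp add: algebra_simps power2_eq_square)
  finally have "(p + q) * r \<le> p\<^sup>2 + q\<^sup>2" by simp
  then have "(p + q) / (p\<^sup>2 + q\<^sup>2) \<le> 1 / r"
    using r assms by (simp add: field_simps add_pos_pos)
  also have "1 / r = p powr (- (1/2)) * q powr (- (1/2))"
  proof -
    have "t powr (- (1/2)) = 1 / sqrt t" if "0 < t" for t :: real
      unfolding powr_minus using that by (simp add: powr_half_sqrt inverse_eq_divide)
    then show ?thesis using assms by (simp add: r_def)
  qed
  finally show ?thesis .
qed

text \<open>
  The real part of the integrand is bounded, but its imaginary part is of order \<open>1 / \<bar>\<xi>\<bar>\<close> at the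
  origin. Complex integrability is needed before real parts can be taken under the integral.
\<close>

lemma integrable_integrand: "set_integrable lborel ({-pi..pi} \<times> {-pi..pi}) (integrand x)"
  unfolding set_integrable_def
proof (rule Bochner_Integration.integrable_bound)
  define h where "h t = indicator {-pi..pi} t * \<bar>t\<bar> powr (- (1/2))" for t :: real
  define m n where "m = real_of_int (fst x)" and "n = real_of_int (snd x)"
  define M where "M = \<bar>real_of_int (fst x)\<bar> + \<bar>real_of_int (snd x)\<bar>"
  show "integrable lborel (\<lambda>\<xi>. 16 * M * (h (fst \<xi>) * h (snd \<xi>)))"
    using integrable_mult_pair[OF integrable_inverse_sqrt integrable_inverse_sqrt]
    unfolding h_def lborel_prod by (rule integrable_mult_right)
  show "(\<lambda>\<xi>. indicator ({-pi..pi} \<times> {-pi..pi}) \<xi> *\<^sub>R integrand x \<xi>) \<in> borel_measurable lborel"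
  proof -
    have [measurable]: "{-pi..pi} \<times> {-pi..pi} \<in> sets (borel :: (real \<times> real) measure)"
      by (intro borel_closed closed_Times) auto
    have [measurable]: "(\<lambda>\<xi>. 1 - exp (- \<i> * complex_of_real (real_point x \<bullet> \<xi>))) \<in> borel_measurable borel"
      by (intro borel_measurable_continuous_onI continuous_intros)
    have [measurable]: "(\<lambda>\<xi>. complex_of_real (1 - (cos (fst \<xi>) + cos (snd \<xi>)) / 2))
        \<in> borel_measurable (borel :: (real \<times> real) measure)"
      by (intro borel_measurable_continuous_onI continuous_intros) auto
    show ?thesis unfolding integrand_eq by measurable
  qed
  have "norm (indicator ({-pi..pi} \<times> {-pi..pi}) \<xi> *\<^sub>R integrand x \<xi>)
        \<le> norm (16 * M * (h (fst \<xi>) * h (snd \<xi>)))" if "fst \<xi> \<noteq> 0 \<and> snd \<xi> \<noteq> 0" for \<xi>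
  proof (cases "\<xi> \<in> {-pi..pi} \<times> {-pi..pi}")
    case True
    define p q where "p = \<bar>fst \<xi>\<bar>" and "q = \<bar>snd \<xi>\<bar>"
    have pq: "0 < p" "0 < q" using that by (auto simp: p_def q_def)
    define D where "D = 1 - (cos (fst \<xi>) + cos (snd \<xi>)) / 2"
    have D: "(p\<^sup>2 + q\<^sup>2) / 16 \<le> D" using denominator_ge[OF True] by (simp add: D_def p_def q_def)
    have pq2: "0 < p\<^sup>2 + q\<^sup>2" using pq by (simp add: add_pos_pos)
    have Dpos: "0 < D" by (rule less_le_trans[OF _ D]) (use pq2 in simp)
    have "\<bar>real_point x \<bullet> \<xi>\<bar> \<le> M * (p + q)"
    proof -
      have "\<bar>m * fst \<xi> + n * snd \<xi>\<bar> \<le> \<bar>m\<bar> * p + \<bar>n\<bar> * q"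
        unfolding p_def q_def by (rule order.trans[OF abs_triangle_ineq]) (simp add: abs_mult)
      also have "\<dots> \<le> M * p + M * q"
        using pq by (intro add_mono mult_right_mono) (auto simp: M_def m_def n_def)
      finally show ?thesis by (simp add: m_def n_def real_point_def inner_prod_def algebra_simps)
    qed
    then have num: "norm (1 - exp (- \<i> * complex_of_real (real_point x \<bullet> \<xi>))) \<le> M * (p + q)"
      using norm_one_minus_cis_le order.trans by blast
    have M: "0 \<le> M" by (simp add: M_def)
    have "norm (integrand x \<xi>) = norm (1 - exp (- \<i> * complex_of_real (real_point x \<bullet> \<xi>))) / D"
      unfolding integrand_eq D_def[symmetric] using Dpos by (simp only: norm_divide norm_of_real abs_of_pos)
    also have "\<dots> \<le> M * (p + q) / ((p\<^sup>2 + q\<^sup>2) / 16)"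
      using num D pq2 M pq by (intro frac_le) auto
    also have "\<dots> = 16 * M * ((p + q) / (p\<^sup>2 + q\<^sup>2))" by simp
    also have "\<dots> \<le> 16 * M * (p powr (- (1/2)) * q powr (- (1/2)))"
      using M by (intro mult_left_mono sum_div_squares_le pq) auto
    finally show ?thesis using True M by (auto simp: h_def p_def q_def)
  qed simp
  then show "AE \<xi> in lborel. norm (indicator ({-pi..pi} \<times> {-pi..pi}) \<xi> *\<^sub>R integrand x \<xi>)
        \<le> norm (16 * M * (h (fst \<xi>) * h (snd \<xi>)))"
    by (rule eventually_mono[OF AE_both_nonzero])
qed

section \<open>The potential kernel as a one-dimensional integral\<close>

definition real_integrand :: "lattice \<Rightarrow> real \<times> real \<Rightarrow> real" where
  "real_integrand x \<xi> = indicator ({-pi..pi} \<times> {-pi..pi}) \<xi> *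
     ((1 - cos (real_of_int (fst x) * fst \<xi> + real_of_int (snd x) * snd \<xi>)) / (1 - (cos (fst \<xi>) + cos (snd \<xi>)) / 2))"

lemma Re_integrand: "Re (indicator ({-pi..pi} \<times> {-pi..pi}) \<xi> *\<^sub>R integrand x \<xi>) = real_integrand x \<xi>"
  unfolding integrand_eq real_integrand_def
  using cos_minus[of "real_of_int (fst x) * fst \<xi> + real_of_int (snd x) * snd \<xi>"]
  by (simp add: Re_exp real_point_def inner_prod_def Re_divide_of_real del: of_real_diff of_real_divide of_real_add cos_minus)

lemma integrable_real_integrand: "integrable (lborel \<Otimes>\<^sub>M lborel) (real_integrand x)"
  using integrable_Re[OF integrable_integrand[of x, unfolded set_integrable_def]]
  unfolding Re_integrand lborel_prod .

lemma potential_kernel_eq: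
  "potential_kernel x = (LINT \<xi>|(lborel \<Otimes>\<^sub>M lborel). real_integrand x \<xi>) / (4 * pi\<^sup>2)"
proof -
  have "potential_kernel x = Re (of_real (1 / (4 * pi\<^sup>2)) *
      (LINT \<xi>|lborel. indicator ({-pi..pi} \<times> {-pi..pi}) \<xi> *\<^sub>R integrand x \<xi>))"
    by (simp add: potential_kernel_def set_lebesgue_integral_def integrand_def power_mult_distrib)
  also have "\<dots> = 1 / (4 * pi\<^sup>2) * Re (LINT \<xi>|lborel. indicator ({-pi..pi} \<times> {-pi..pi}) \<xi> *\<^sub>R integrand x \<xi>)"
    by (simp del: of_real_divide of_real_power)
  also have "Re (LINT \<xi>|lborel. indicator ({-pi..pi} \<times> {-pi..pi}) \<xi> *\<^sub>R integrand x \<xi>)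
      = (LINT \<xi>|lborel. real_integrand x \<xi>)"
    using integral_Re[OF integrable_integrand[of x, unfolded set_integrable_def]]
    unfolding Re_integrand by simp
  finally show ?thesis by (simp add: lborel_prod)
qed

lemma potential_kernel_swap: "potential_kernel (n, m) = potential_kernel (m, n)"
proof -
  have "(LINT \<xi>|(lborel \<Otimes>\<^sub>M lborel). real_integrand (n, m) \<xi>)
      = (LINT (\<theta>, \<phi>)|(lborel \<Otimes>\<^sub>M lborel). real_integrand (n, m) (\<phi>, \<theta>))"
    using integrable_real_integrand by (intro lborel_pair.integral_product_swap[symmetric]) auto
  also have "\<dots> = (LINT \<xi>|(lborel \<Otimes>\<^sub>M lborel). real_integrand (m, n) \<xi>)"
    by (intro Bochner_Integration.integral_cong refl)
       (auto simp: real_integrand_def indicator_def add.commute)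
  finally show ?thesis by (simp add: potential_kernel_eq)
qed

text \<open>
  The integrand of the one-dimensional formula. At \<open>\<theta> = 0\<close> the denominator vanishes and the value
  is the default \<open>0\<close>, so identities between profiles are only claimed for \<open>\<theta> > 0\<close>.
\<close>

definition profile :: "lattice \<Rightarrow> real \<Rightarrow> real" where
  "profile x \<theta> = (1 - cos (real_of_int (fst x) * \<theta>) * exp (- (\<bar>real_of_int (snd x)\<bar> * decay \<theta>))) / sinh (decay \<theta>)"

text \<open>
  Fubini and the inner Poisson integral give an integral over \<open>{-pi..pi}\<close> of an even function;
  half of it lives on \<open>{0..pi}\<close>.
\<close>

lemma potential_kernel_integral:
  "(profile x has_integral (pi / 2 * potential_kernel x)) {0..pi}"
proof -
  let ?g = "\<lambda>\<theta>. 4 * pi * profile x \<bar>\<theta>\<bar>"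
  let ?G = "\<lambda>\<theta>. LINT \<phi>|lborel. real_integrand x (\<theta>, \<phi>)"
  have even: "cos (real_of_int k * \<theta>) = cos (real_of_int k * \<bar>\<theta>\<bar>)" for k \<theta>
    by (cases "0 \<le> \<theta>") (auto simp: abs_if)
  have inner: "?G \<theta> = indicator {-pi..pi} \<theta> * ?g \<theta>" if "\<theta> \<noteq> 0" for \<theta>
  proof (cases "\<theta> \<in> {-pi..pi}")
    case True
    let ?f = "\<lambda>\<phi>. (1 - cos (real_of_int (fst x) * \<theta> + real_of_int (snd x) * \<phi>)) / (1 - (cos \<theta> + cos \<phi>) / 2)"
    have "0 < decay \<bar>\<theta>\<bar>" using True that by (intro decay_pos) auto
    then have "1 < cosh (decay \<bar>\<theta>\<bar>)" using cosh_real_ge_1[of "decay \<bar>\<theta>\<bar>"] by (simp add: less_le)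
    then have "cos \<theta> < 1" by (simp add: cosh_decay)
    then have "1 - (cos \<theta> + cos \<phi>) / 2 \<noteq> 0" for \<phi> :: real
      using add_less_le_mono[OF \<open>cos \<theta> < 1\<close> cos_le_one[of \<phi>]] by simp
    then have "set_integrable lborel {-pi..pi} ?f"
      by (intro borel_integrable_atLeastAtMost' continuous_intros) auto
    then have "(LINT \<phi>:{-pi..pi}|lborel. ?f \<phi>) = integral {-pi..pi} ?f"
      by (rule set_borel_integral_eq_integral)
    moreover have "integral {-pi..pi} ?f = ?g \<theta>"
      using integral_unique[OF inner_integral[OF True that, of "fst x" "snd x"]] even[of "fst x" \<theta>]
      by (simp add: profile_def)
    moreover have "?G \<theta> = (LINT \<phi>:{-pi..pi}|lborel. ?f \<phi>)"
      unfolding set_lebesgue_integral_def using True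
      by (intro Bochner_Integration.integral_cong) (auto simp: real_integrand_def indicator_def)
    moreover have "indicator {-pi..pi} \<theta> = (1 :: real)" using True by simp
    ultimately show ?thesis by (simp only: mult_1)
  next
    case False
    then have "real_integrand x (\<theta>, \<phi>) = 0" for \<phi> by (auto simp: real_integrand_def)
    then show ?thesis using False by simp
  qed
  have intG: "integrable lborel ?G"
    by (rule lborel_pair.integrable_fst'[OF integrable_real_integrand])
  have "(?G has_integral (LINT \<theta>|lborel. ?G \<theta>)) UNIV"
    using intG by (rule has_integral_integral_lborel)
  moreover have "(LINT \<theta>|lborel. ?G \<theta>) = 4 * pi\<^sup>2 * potential_kernel x"
    using lborel_pair.integral_fst'[OF integrable_real_integrand[of x]] by (simp add: potential_kernel_eq)
  ultimately have G: "(?G has_integral 4 * pi\<^sup>2 * potential_kernel x) UNIV" by (simp only:)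
  have "indicator {-pi..pi} \<theta> * ?g \<theta> = ?G \<theta>" if "\<theta> \<in> UNIV - {0}" for \<theta>
    using that by (intro inner[symmetric]) blast
  then have "((\<lambda>\<theta>. indicator {-pi..pi} \<theta> * ?g \<theta>) has_integral 4 * pi\<^sup>2 * potential_kernel x) UNIV"
    by (rule has_integral_spike[OF negligible_sing[of 0] _ G])
  then have "((\<lambda>\<theta>. if \<theta> \<in> {-pi..pi} then ?g \<theta> else 0) has_integral 4 * pi\<^sup>2 * potential_kernel x) UNIV"
    by (rule has_integral_eq[rotated]) (auto simp: indicator_def)
  then have full: "(?g has_integral 4 * pi\<^sup>2 * potential_kernel x) {-pi..pi}"
    by (simp only: has_integral_restrict_UNIV)
  then have int: "?g integrable_on {0..pi}"
    by (intro integrable_on_subinterval[OF has_integral_integrable[OF full]]) auto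
  define J where "J = integral {0..pi} ?g"
  have J: "(?g has_integral J) {0..pi}" unfolding J_def using int by (rule integrable_integral)
  have "((\<lambda>\<theta>. ?g (- \<theta>)) has_integral J) {-pi..-0}"
    by (rule iffD2[OF has_integral_reflect_real J])
  then have "(?g has_integral J) {-pi..0}" by (simp only: abs_minus_cancel minus_zero)
  then have "(?g has_integral (J + J)) {-pi..pi}"
    using J by (intro has_integral_combine[of "-pi" 0 pi]) auto
  then have "J + J = 4 * pi\<^sup>2 * potential_kernel x"
    using full has_integral_unique by blast
  then have "J = 2 * pi\<^sup>2 * potential_kernel x" by simp
  then have "((\<lambda>\<theta>. 1 / (4 * pi) * ?g \<theta>) has_integral 1 / (4 * pi) * (2 * pi\<^sup>2 * potential_kernel x)) {0..pi}"
    using J by (intro has_integral_mult_right) simp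
  moreover have "1 / (4 * pi) * (2 * pi\<^sup>2 * potential_kernel x) = pi / 2 * potential_kernel x"
    by (simp add: power2_eq_square)
  moreover have "1 / (4 * pi) * ?g \<theta> = profile x \<theta>" if "\<theta> \<in> {0..pi}" for \<theta>
    using that by simp
  ultimately show ?thesis by (metis (no_types, lifting) has_integral_eq)
qed

section \<open>Differences of the potential kernel\<close>

text \<open>
  The derivative of \<open>decay\<close>.
\<close>

definition slope :: "real \<Rightarrow> real" where
  "slope \<theta> = cos (\<theta> / 2) / cosh (decay \<theta> / 2)"

definition decay_cos :: "int \<Rightarrow> int \<Rightarrow> real" where
  "decay_cos m n = integral {0..pi} (\<lambda>\<theta>. exp (- (n * decay \<theta>)) * cos (m * \<theta>))"

definition decay_cos_tanh :: "int \<Rightarrow> int \<Rightarrow> real" where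
  "decay_cos_tanh m n = integral {0..pi} (\<lambda>\<theta>. exp (- (n * decay \<theta>)) * cos (m * \<theta>) * tanh (decay \<theta> / 2))"

definition decay_sin_slope :: "int \<Rightarrow> int \<Rightarrow> real" where
  "decay_sin_slope m n = integral {0..pi} (\<lambda>\<theta>. exp (- (n * decay \<theta>)) * sin (m * \<theta>) * slope \<theta>)"

lemma decay_0 [simp]: "decay 0 = 0"
  by (simp add: decay_def)

lemma decay_nonneg: "0 \<le> \<theta> \<Longrightarrow> \<theta> \<le> pi \<Longrightarrow> 0 \<le> decay \<theta>"
  using decay_ge[of \<theta>] by linarith

lemma has_real_derivative_decay: "(decay has_real_derivative slope \<theta>) (at \<theta> within S)"
proof -
  have "cosh (decay \<theta> / 2) = sqrt ((sin (\<theta> / 2))\<^sup>2 + 1)"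
    by (simp add: decay_def cosh_arsinh_real)
  moreover have "((\<lambda>\<theta>. sin (\<theta> / 2)) has_real_derivative cos (\<theta> / 2) / 2) (at \<theta> within S)"
    by (auto intro!: derivative_eq_intros)
  from DERIV_chain2[OF arsinh_real_has_field_derivative this]
  have "((\<lambda>\<theta>. 2 * arsinh (sin (\<theta> / 2))) has_real_derivative
      2 * (1 / sqrt ((sin (\<theta> / 2))\<^sup>2 + 1) * (cos (\<theta> / 2) / 2))) (at \<theta> within S)"
    by (rule DERIV_cmult)
  ultimately show ?thesis
    unfolding decay_def[abs_def] slope_def by simp
qed

lemma continuous_on_decay [continuous_intros]: "continuous_on S decay"
  using has_real_derivative_decay by (intro DERIV_continuous_on)

lemma continuous_on_slope [continuous_intros]: "continuous_on S slope"
  unfolding slope_def[abs_def] by (intro continuous_intros) (auto intro: continuous_on_decay)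

lemma has_integral_decay_cos:
  "((\<lambda>\<theta>. exp (- (n * decay \<theta>)) * cos (m * \<theta>)) has_integral decay_cos m n) {0..pi}"
  unfolding decay_cos_def
  by (intro integrable_integral integrable_continuous_interval continuous_intros)

lemma has_integral_decay_cos_tanh:
  "((\<lambda>\<theta>. exp (- (n * decay \<theta>)) * cos (m * \<theta>) * tanh (decay \<theta> / 2)) has_integral decay_cos_tanh m n) {0..pi}"
  unfolding decay_cos_tanh_def
  by (intro integrable_integral integrable_continuous_interval continuous_intros) auto

lemma has_integral_decay_sin_slope:
  "((\<lambda>\<theta>. exp (- (n * decay \<theta>)) * sin (m * \<theta>) * slope \<theta>) has_integral decay_sin_slope m n) {0..pi}"
  unfolding decay_sin_slope_def
  by (intro integrable_integral integrable_continuous_interval continuous_intros)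

lemma potential_kernel_diff:
  assumes "(g has_integral J) {0..pi}"
    and "\<And>\<theta>. 0 < \<theta> \<Longrightarrow> \<theta> \<le> pi \<Longrightarrow> profile y \<theta> - profile x \<theta> = g \<theta>"
  shows "potential_kernel y - potential_kernel x = 2 / pi * J"
proof -
  have "((\<lambda>\<theta>. profile y \<theta> - profile x \<theta>) has_integral
      (pi / 2 * potential_kernel y - pi / 2 * potential_kernel x)) {0..pi}"
    by (intro has_integral_diff potential_kernel_integral)
  moreover have "((\<lambda>\<theta>. profile y \<theta> - profile x \<theta>) has_integral J) {0..pi}"
    by (rule has_integral_spike_finite[OF _ _ assms(1), of "{0}"]) (use assms(2) in auto)
  ultimately have "pi / 2 * potential_kernel y - pi / 2 * potential_kernel x = J"
    by (rule has_integral_unique)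
  then show ?thesis by (simp add: field_simps)
qed

text \<open>
  All four quotients simplify after passing to half arguments, because
  \<open>sinh (decay \<theta> / 2) = sin (\<theta> / 2)\<close>.
\<close>

lemma half_decay_identities:
  assumes "0 < \<theta>" "\<theta> \<le> pi"
  shows "(1 - exp (- decay \<theta>)) / sinh (decay \<theta>) = 1 - tanh (decay \<theta> / 2)"
    and "(1 - exp (decay \<theta>)) / sinh (decay \<theta>) = - 1 - tanh (decay \<theta> / 2)"
    and "(1 - cos \<theta>) / sinh (decay \<theta>) = tanh (decay \<theta> / 2)"
    and "sin \<theta> / sinh (decay \<theta>) = slope \<theta>"
proof -
  define S C where "S = sinh (decay \<theta> / 2)" and "C = cosh (decay \<theta> / 2)"
  have S: "0 < S" using decay_pos[OF assms] by (simp add: S_def)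
  have C: "0 < C" by (simp add: C_def)
  have sinh: "sinh (decay \<theta>) = 2 * S * C"
    using sinh_double[of "decay \<theta> / 2"] by (simp add: S_def C_def)
  have cosh: "cosh (decay \<theta>) = 1 + 2 * S\<^sup>2"
    using cosh_double[of "decay \<theta> / 2"] cosh_square_eq[of "decay \<theta> / 2"] by (simp add: S_def C_def)
  have tanh: "tanh (decay \<theta> / 2) = S / C" by (simp add: tanh_def S_def C_def)
  have minus: "1 - exp (- decay \<theta>) = 2 * S * (C - S)"
    using cosh_minus_sinh[of "decay \<theta>"] sinh cosh by (simp add: power2_eq_square algebra_simps)
  show "(1 - exp (- decay \<theta>)) / sinh (decay \<theta>) = 1 - tanh (decay \<theta> / 2)"
    unfolding minus sinh tanh using S C by (simp add: field_simps)
  have plus: "1 - exp (decay \<theta>) = 2 * S * (- C - S)"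
    using cosh_plus_sinh[of "decay \<theta>"] sinh cosh by (simp add: power2_eq_square algebra_simps)
  show "(1 - exp (decay \<theta>)) / sinh (decay \<theta>) = - 1 - tanh (decay \<theta> / 2)"
    unfolding plus sinh tanh using S C by (simp add: field_simps)
  have cos: "1 - cos \<theta> = 2 * S\<^sup>2" using cosh cosh_decay[of \<theta>] by simp
  show "(1 - cos \<theta>) / sinh (decay \<theta>) = tanh (decay \<theta> / 2)"
    unfolding cos sinh tanh using S C by (simp add: field_simps power2_eq_square)
  have "sin \<theta> = 2 * S * cos (\<theta> / 2)"
    using sin_double[of "\<theta> / 2"] sinh_half_decay[of \<theta>] by (simp add: S_def)
  then show "sin \<theta> / sinh (decay \<theta>) = slope \<theta>"
    unfolding sinh slope_def C_def[symmetric] using S C by simp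
qed

lemma profile_diff_factor:
  fixes c E x h :: real
  shows "(1 - c * (E * x)) / h - (1 - c * E) / h = E * c * ((1 - x) / h)"
  by (cases "h = 0") (simp_all add: field_simps)

lemma potential_kernel_up:
  assumes "0 \<le> n"
  shows "potential_kernel (m, n + 1) - potential_kernel (m, n)
      = 2 / pi * (decay_cos m n - decay_cos_tanh m n)"
proof (rule potential_kernel_diff)
  show "((\<lambda>\<theta>. exp (- (n * decay \<theta>)) * cos (m * \<theta>) - exp (- (n * decay \<theta>)) * cos (m * \<theta>) * tanh (decay \<theta> / 2))
      has_integral (decay_cos m n - decay_cos_tanh m n)) {0..pi}"
    by (intro has_integral_diff has_integral_decay_cos has_integral_decay_cos_tanh)
  fix \<theta> :: real assume \<theta>: "0 < \<theta>" "\<theta> \<le> pi"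
  have "exp (- ((n + 1) * decay \<theta>)) = exp (- (n * decay \<theta>)) * exp (- decay \<theta>)"
    by (simp add: exp_add[symmetric] algebra_simps)
  then have "profile (m, n + 1) \<theta> - profile (m, n) \<theta>
      = exp (- (n * decay \<theta>)) * cos (m * \<theta>) * ((1 - exp (- decay \<theta>)) / sinh (decay \<theta>))"
    using assms unfolding profile_def profile_diff_factor[symmetric] by simp
  then show "profile (m, n + 1) \<theta> - profile (m, n) \<theta>
      = exp (- (n * decay \<theta>)) * cos (m * \<theta>) - exp (- (n * decay \<theta>)) * cos (m * \<theta>) * tanh (decay \<theta> / 2)"
    unfolding half_decay_identities[OF \<theta>] by (simp add: right_diff_distrib)
qed

lemma potential_kernel_down:
  assumes "1 \<le> n"
  shows "potential_kernel (m, n - 1) - potential_kernel (m, n)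
      = 2 / pi * (- decay_cos m n - decay_cos_tanh m n)"
proof (rule potential_kernel_diff)
  show "((\<lambda>\<theta>. - (exp (- (n * decay \<theta>)) * cos (m * \<theta>)) - exp (- (n * decay \<theta>)) * cos (m * \<theta>) * tanh (decay \<theta> / 2))
      has_integral (- decay_cos m n - decay_cos_tanh m n)) {0..pi}"
    by (intro has_integral_diff has_integral_neg has_integral_decay_cos has_integral_decay_cos_tanh)
  fix \<theta> :: real assume \<theta>: "0 < \<theta>" "\<theta> \<le> pi"
  have "exp (- ((n - 1) * decay \<theta>)) = exp (- (n * decay \<theta>)) * exp (decay \<theta>)"
    by (simp add: exp_add[symmetric] algebra_simps)
  then have "profile (m, n - 1) \<theta> - profile (m, n) \<theta>
      = exp (- (n * decay \<theta>)) * cos (m * \<theta>) * ((1 - exp (decay \<theta>)) / sinh (decay \<theta>))"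
    using assms unfolding profile_def profile_diff_factor[symmetric] by simp
  then show "profile (m, n - 1) \<theta> - profile (m, n) \<theta>
      = - (exp (- (n * decay \<theta>)) * cos (m * \<theta>)) - exp (- (n * decay \<theta>)) * cos (m * \<theta>) * tanh (decay \<theta> / 2)"
    unfolding half_decay_identities[OF \<theta>] by (simp add: right_diff_distrib)
qed

lemma profile_diff_rotate:
  fixes c s E c' s' h :: real
  shows "(1 - (c * c' - s * s') * E) / h - (1 - c * E) / h = E * s * (s' / h) + E * c * ((1 - c') / h)"
  by (cases "h = 0") (simp_all add: field_simps)

lemma potential_kernel_right:
  assumes "0 \<le> n"
  shows "potential_kernel (m + 1, n) - potential_kernel (m, n)
      = 2 / pi * (decay_sin_slope m n + decay_cos_tanh m n)"
proof (rule potential_kernel_diff)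
  show "((\<lambda>\<theta>. exp (- (n * decay \<theta>)) * sin (m * \<theta>) * slope \<theta> + exp (- (n * decay \<theta>)) * cos (m * \<theta>) * tanh (decay \<theta> / 2))
      has_integral (decay_sin_slope m n + decay_cos_tanh m n)) {0..pi}"
    by (intro has_integral_add has_integral_decay_sin_slope has_integral_decay_cos_tanh)
  fix \<theta> :: real assume \<theta>: "0 < \<theta>" "\<theta> \<le> pi"
  have "cos ((m + 1) * \<theta>) = cos (m * \<theta>) * cos \<theta> - sin (m * \<theta>) * sin \<theta>"
    by (simp add: distrib_right cos_add)
  then have "profile (m + 1, n) \<theta> - profile (m, n) \<theta>
      = exp (- (n * decay \<theta>)) * sin (m * \<theta>) * (sin \<theta> / sinh (decay \<theta>))
      + exp (- (n * decay \<theta>)) * cos (m * \<theta>) * ((1 - cos \<theta>) / sinh (decay \<theta>))"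
    using assms unfolding profile_def profile_diff_rotate[symmetric] by simp
  then show "profile (m + 1, n) \<theta> - profile (m, n) \<theta>
      = exp (- (n * decay \<theta>)) * sin (m * \<theta>) * slope \<theta> + exp (- (n * decay \<theta>)) * cos (m * \<theta>) * tanh (decay \<theta> / 2)"
    unfolding half_decay_identities[OF \<theta>] .
qed

lemma potential_kernel_reflect:
  "potential_kernel (- m, n) = potential_kernel (m, n)"
  "potential_kernel (m, - n) = potential_kernel (m, n)"
proof -
  have "profile (- m, n) = profile (m, n)" "profile (m, - n) = profile (m, n)"
    by (auto simp: profile_def)
  then show "potential_kernel (- m, n) = potential_kernel (m, n)"
    "potential_kernel (m, - n) = potential_kernel (m, n)"
    using has_integral_unique[OF potential_kernel_integral[of "(m, n)"], of "pi / 2 * potential_kernel (- m, n)"]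
      has_integral_unique[OF potential_kernel_integral[of "(m, n)"], of "pi / 2 * potential_kernel (m, - n)"]
      potential_kernel_integral[of "(- m, n)"] potential_kernel_integral[of "(m, - n)"] by simp_all
qed

lemma potential_kernel_left:
  assumes "0 \<le> n"
  shows "potential_kernel (m - 1, n) - potential_kernel (m, n)
      = 2 / pi * (- decay_sin_slope m n + decay_cos_tanh m n)"
proof -
  have "potential_kernel (m - 1, n) - potential_kernel (m, n)
      = potential_kernel (- m + 1, n) - potential_kernel (- m, n)"
    using potential_kernel_reflect(1)[of "m - 1" n] potential_kernel_reflect(1)[of m n] by simp
  also have "\<dots> = 2 / pi * (decay_sin_slope (- m) n + decay_cos_tanh (- m) n)"
    by (rule potential_kernel_right[OF assms])
  also have "decay_sin_slope (- m) n = - decay_sin_slope m n"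
    by (simp add: decay_sin_slope_def)
  also have "decay_cos_tanh (- m) n = decay_cos_tanh m n"
    by (simp add: decay_cos_tanh_def)
  finally show ?thesis .
qed

text \<open>
  Integrate the derivative of \<open>exp (- n * decay \<theta>) * sin (m \<theta>)\<close>, whose boundary values vanish since
  \<open>m\<close> is an integer. Horizontal and vertical differences thus involve the same integral, with
  ratio \<open>m / n\<close> as for the gradient of \<open>ln \<bar>x\<bar>\<close>.
\<close>

lemma decay_sin_slope_eq:
  assumes "1 \<le> n"
  shows "decay_sin_slope m n = m / n * decay_cos m n"
proof -
  let ?F = "\<lambda>\<theta>. - (exp (- (real_of_int n * decay \<theta>)) * sin (real_of_int m * \<theta>))"
  have "((\<lambda>\<theta>. real_of_int n * (exp (- (real_of_int n * decay \<theta>)) * sin (real_of_int m * \<theta>) * slope \<theta>) - real_of_int m * (exp (- (real_of_int n * decay \<theta>)) * cos (real_of_int m * \<theta>)))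
      has_integral (?F pi - ?F 0)) {0..pi}"
  proof (rule fundamental_theorem_of_calculus)
    fix \<theta> :: real assume "\<theta> \<in> {0..pi}"
    show "(?F has_vector_derivative real_of_int n * (exp (- (real_of_int n * decay \<theta>)) * sin (real_of_int m * \<theta>) * slope \<theta>) - real_of_int m * (exp (- (real_of_int n * decay \<theta>)) * cos (real_of_int m * \<theta>)))
        (at \<theta> within {0..pi})"
      unfolding has_real_derivative_iff_has_vector_derivative[symmetric]
      by (auto intro!: derivative_eq_intros has_real_derivative_decay simp: algebra_simps)
  qed simp
  moreover have "?F pi - ?F 0 = 0" using sin_npi_int[of m] by (simp add: mult.commute)
  moreover have "((\<lambda>\<theta>. real_of_int n * (exp (- (real_of_int n * decay \<theta>)) * sin (real_of_int m * \<theta>) * slope \<theta>) - real_of_int m * (exp (- (real_of_int n * decay \<theta>)) * cos (real_of_int m * \<theta>)))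
      has_integral (real_of_int n * decay_sin_slope m n - m * decay_cos m n)) {0..pi}"
    by (intro has_integral_diff has_integral_mult_right has_integral_decay_cos has_integral_decay_sin_slope)
  ultimately have "real_of_int n * decay_sin_slope m n - real_of_int m * decay_cos m n = 0"
    by (simp only: has_integral_unique)
  then show ?thesis using assms by (simp add: field_simps)
qed

section \<open>Bounds for the difference integrals\<close>

lemma sinh_ge: "0 \<le> x \<Longrightarrow> x \<le> sinh (x :: real)"
  using real_le_x_sinh[of x] by (simp add: sinh_field_def exp_minus)

lemma decay_le: "0 \<le> \<theta> \<Longrightarrow> decay \<theta> \<le> \<theta>"
proof -
  assume \<theta>: "0 \<le> \<theta>"
  have "sinh (decay \<theta> / 2) \<le> sinh (\<theta> / 2)"
    unfolding sinh_half_decay using sin_x_le_x[of "\<theta> / 2"] sinh_ge[of "\<theta> / 2"] \<theta> by simp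
  then show ?thesis by simp
qed

lemma slope_bounds:
  assumes "0 \<le> \<theta>" "\<theta> \<le> pi"
  shows "0 \<le> slope \<theta>" "1 - slope \<theta> \<le> \<theta>"
proof -
  define S C where "S = sin (\<theta> / 2)" and "C = cosh (decay \<theta> / 2)"
  have C: "1 \<le> C" "C\<^sup>2 = 1 + S\<^sup>2"
    using cosh_square_eq[of "decay \<theta> / 2"] by (simp_all add: C_def S_def sinh_half_decay cosh_real_ge_1)
  have c: "0 \<le> cos (\<theta> / 2)" "cos (\<theta> / 2) \<le> 1" using assms by (auto intro!: cos_ge_zero)
  show "0 \<le> slope \<theta>" using c C unfolding slope_def by simp
  have S: "0 \<le> S" "S \<le> 1" "S \<le> \<theta> / 2"
    unfolding S_def using assms sin_x_le_x[of "\<theta> / 2"] by (auto intro!: sin_ge_zero)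
  have "1 - slope \<theta> = (C - cos (\<theta> / 2)) / C" using C by (simp add: slope_def C_def[symmetric] field_simps)
  also have "\<dots> \<le> C - cos (\<theta> / 2)"
  proof -
    have "1 * (C - cos (\<theta> / 2)) \<le> C * (C - cos (\<theta> / 2))"
      using C c by (intro mult_right_mono) linarith+
    then show ?thesis using C by (simp add: divide_le_eq mult.commute)
  qed
  also have "\<dots> \<le> C\<^sup>2 - (cos (\<theta> / 2))\<^sup>2"
    using C c self_le_power[of C 2] power_le_one_iff[of "cos (\<theta> / 2)" 2] mult_left_le[of "cos (\<theta> / 2)" "cos (\<theta> / 2)"]
    by (simp add: power2_eq_square diff_mono)
  also have "\<dots> = 2 * S\<^sup>2" using C by (simp add: S_def cos_squared_eq)
  also have "\<dots> \<le> 2 * S" using S by (simp add: power2_eq_square mult_left_le)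
  also have "\<dots> \<le> \<theta>" using S by simp
  finally show "1 - slope \<theta> \<le> \<theta>" .
qed

lemma tanh_half_decay_bounds:
  assumes "0 \<le> \<theta>" "\<theta> \<le> pi"
  shows "0 \<le> tanh (decay \<theta> / 2)" "tanh (decay \<theta> / 2) \<le> \<theta>"
proof -
  have S: "0 \<le> sin (\<theta> / 2)" "sin (\<theta> / 2) \<le> \<theta> / 2"
    using assms sin_x_le_x[of "\<theta> / 2"] by (auto intro!: sin_ge_zero)
  show "0 \<le> tanh (decay \<theta> / 2)" using decay_nonneg[OF assms] by simp
  have "tanh (decay \<theta> / 2) \<le> sin (\<theta> / 2) / 1"
    unfolding tanh_def sinh_half_decay using S by (intro divide_left_mono cosh_real_ge_1) auto
  then show "tanh (decay \<theta> / 2) \<le> \<theta>" using S assms by linarith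
qed

lemma moment_integral:
  fixes k :: real
  assumes "0 < k"
  shows "\<exists>J. ((\<lambda>\<theta>. \<theta> * exp (- (k * \<theta>))) has_integral J) {0..pi} \<and> J \<le> 1 / k\<^sup>2"
proof -
  let ?F = "\<lambda>\<theta>. - ((\<theta> / k + 1 / k\<^sup>2) * exp (- (k * \<theta>)))"
  have "((\<lambda>\<theta>. \<theta> * exp (- (k * \<theta>))) has_integral (?F pi - ?F 0)) {0..pi}"
  proof (rule fundamental_theorem_of_calculus)
    fix \<theta> :: real assume "\<theta> \<in> {0..pi}"
    show "(?F has_vector_derivative \<theta> * exp (- (k * \<theta>))) (at \<theta> within {0..pi})"
      unfolding has_real_derivative_iff_has_vector_derivative[symmetric]
      using assms by (auto intro!: derivative_eq_intros simp: field_simps power2_eq_square)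
  qed simp
  moreover have "?F pi - ?F 0 \<le> 1 / k\<^sup>2" using assms by simp
  ultimately show ?thesis by blast
qed

lemma exp_decay_le:
  assumes "0 \<le> \<theta>" "\<theta> \<le> pi" "0 \<le> n"
  shows "exp (- (real_of_int n * decay \<theta>)) \<le> exp (- (n / 4 * \<theta>))"
  using mult_left_mono[OF decay_ge[OF assms(1,2)], of "real_of_int n"] assms(3) by simp

lemma abs_has_integral_le:
  fixes f g :: "real \<Rightarrow> real"
  assumes "(f has_integral I) S" "(g has_integral J) S" "\<And>x. x \<in> S \<Longrightarrow> \<bar>f x\<bar> \<le> g x"
  shows "\<bar>I\<bar> \<le> J"
  using integral_norm_bound_integral[of f S g] assms
  by (auto simp: has_integral_integrable_integral)

text \<open>
  Since \<open>decay \<theta> \<ge> \<theta> / 4\<close>, the exponential has integral of order \<open>1 / n\<close>, and the additional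
  factor \<open>\<theta>\<close> gains another \<open>1 / n\<close>.
\<close>

lemma abs_integral_le_moment:
  assumes n: "1 \<le> n" and f: "(f has_integral J) {0..pi}"
    and bound: "\<And>\<theta>. 0 \<le> \<theta> \<Longrightarrow> \<theta> \<le> pi \<Longrightarrow> \<bar>f \<theta>\<bar> \<le> exp (- (real_of_int n * decay \<theta>)) * \<theta>"
  shows "\<bar>J\<bar> \<le> 16 / (real_of_int n)\<^sup>2"
proof -
  obtain M where M: "((\<lambda>\<theta>. \<theta> * exp (- (n / 4 * \<theta>))) has_integral M) {0..pi}" "M \<le> 1 / (real_of_int n / 4)\<^sup>2"
    using moment_integral[of "n / 4"] n by auto
  have "\<bar>J\<bar> \<le> M"
  proof (rule abs_has_integral_le[OF f M(1)])
    fix \<theta> :: real assume \<theta>: "\<theta> \<in> {0..pi}"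
    have "\<bar>f \<theta>\<bar> \<le> exp (- (n / 4 * \<theta>)) * \<theta>"
      using bound[of \<theta>] mult_right_mono[OF exp_decay_le[of \<theta> n], of \<theta>] \<theta> n by auto
    then show "\<bar>f \<theta>\<bar> \<le> \<theta> * exp (- (n / 4 * \<theta>))" by (simp add: mult.commute)
  qed
  then show ?thesis using M(2) by (simp add: power_divide)
qed

lemma decay_cos_tanh_bound:
  assumes "1 \<le> n"
  shows "\<bar>decay_cos_tanh m n\<bar> \<le> 16 / (real_of_int n)\<^sup>2"
proof (rule abs_integral_le_moment[OF assms has_integral_decay_cos_tanh])
  fix \<theta> :: real assume \<theta>: "0 \<le> \<theta>" "\<theta> \<le> pi"
  have "\<bar>cos (m * \<theta>) * tanh (decay \<theta> / 2)\<bar> \<le> 1 * \<theta>"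
    unfolding abs_mult using tanh_half_decay_bounds[OF \<theta>] by (intro mult_mono) auto
  then show "\<bar>exp (- (n * decay \<theta>)) * cos (m * \<theta>) * tanh (decay \<theta> / 2)\<bar> \<le> exp (- (n * decay \<theta>)) * \<theta>"
    by (simp add: abs_mult mult.assoc)
qed

text \<open>
  With \<open>\<theta>\<close> in place of \<open>decay \<theta>\<close> the integral is elementary and equals \<open>n / (n\<^sup>2 + m\<^sup>2)\<close> up to an
  exponentially small boundary term. As \<open>decay \<theta> \<le> \<theta>\<close>, the replacement costs at most the integral
  of \<open>exp (- n * decay \<theta>) - exp (- n * \<theta>)\<close>. The first term differs from an exact derivative by the
  factor \<open>slope \<theta>\<close>, which is \<open>1\<close> up to \<open>\<theta>\<close>.
\<close>

lemma decay_cos_bound: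
  assumes n: "1 \<le> n"
  shows "\<bar>decay_cos m n - n / (real_of_int n ^ 2 + real_of_int m ^ 2)\<bar> \<le> 17 / (real_of_int n)\<^sup>2"
proof -
  define N M where "N = real_of_int n" and "M = real_of_int m"
  have N: "1 \<le> N" using n by (simp add: N_def)
  have nz: "N\<^sup>2 + M\<^sup>2 > 0" using N by (simp add: add_pos_nonneg)
  have piN: "N \<le> exp (N * pi)"
  proof -
    have "N * 1 \<le> N * pi" using N pi_gt3 by (intro mult_left_mono) auto
    then show ?thesis using exp_ge_add_one_self[of "N * pi"] by linarith
  qed
  let ?F = "\<lambda>\<theta>. exp (- (N * \<theta>)) * (M * sin (M * \<theta>) - N * cos (M * \<theta>)) / (N\<^sup>2 + M\<^sup>2)"
  have exact: "((\<lambda>\<theta>. exp (- (N * \<theta>)) * cos (M * \<theta>)) has_integral (?F pi - ?F 0)) {0..pi}"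
  proof (rule fundamental_theorem_of_calculus)
    fix \<theta> :: real assume "\<theta> \<in> {0..pi}"
    have "(?F has_real_derivative
       (- N * exp (- (N * \<theta>)) * (M * sin (M * \<theta>) - N * cos (M * \<theta>))
         + exp (- (N * \<theta>)) * (M * (M * cos (M * \<theta>)) + N * (M * sin (M * \<theta>)))) / (N\<^sup>2 + M\<^sup>2)) (at \<theta> within {0..pi})"
      using N by (auto intro!: derivative_eq_intros)
    also have "(- N * exp (- (N * \<theta>)) * (M * sin (M * \<theta>) - N * cos (M * \<theta>))
         + exp (- (N * \<theta>)) * (M * (M * cos (M * \<theta>)) + N * (M * sin (M * \<theta>)))) / (N\<^sup>2 + M\<^sup>2)
       = exp (- (N * \<theta>)) * cos (M * \<theta>) * (N\<^sup>2 + M\<^sup>2) / (N\<^sup>2 + M\<^sup>2)"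
      by (simp add: algebra_simps power2_eq_square)
    also have "\<dots> = exp (- (N * \<theta>)) * cos (M * \<theta>)"
      by (rule nonzero_mult_div_cancel_right[OF less_imp_neq[OF nz, symmetric]])
    finally show "(?F has_vector_derivative exp (- (N * \<theta>)) * cos (M * \<theta>)) (at \<theta> within {0..pi})"
      by (simp only: has_real_derivative_iff_has_vector_derivative)
  qed simp
  have F0: "?F 0 = - (N / (N\<^sup>2 + M\<^sup>2))" by simp
  have "sin (M * pi) = 0" using sin_npi_int[of m] by (simp add: M_def mult.commute)
  then have "\<bar>?F pi\<bar> = exp (- (N * pi)) * (N * \<bar>cos (M * pi)\<bar>) / (N\<^sup>2 + M\<^sup>2)"
    using N nz by (simp add: abs_mult)
  also have "\<dots> \<le> (1 / N) * (N * 1) / N\<^sup>2"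
    using N piN by (intro frac_le mult_mono) (auto simp: exp_minus field_simps)
  finally have Fpi: "\<bar>?F pi\<bar> \<le> 1 / N\<^sup>2" using N by simp
  let ?D = "\<lambda>\<theta>. exp (- (N * decay \<theta>)) - exp (- (N * \<theta>))"
  define I1 where "I1 = integral {0..pi} (\<lambda>\<theta>. exp (- (N * decay \<theta>)) * (1 - slope \<theta>))"
  have I1: "((\<lambda>\<theta>. exp (- (N * decay \<theta>)) * (1 - slope \<theta>)) has_integral I1) {0..pi}"
    unfolding I1_def by (intro integrable_integral integrable_continuous_interval continuous_intros)
  have I1_le: "I1 \<le> 16 / N\<^sup>2"
  proof -
    have "\<bar>exp (- (n * decay \<theta>)) * (1 - slope \<theta>)\<bar> \<le> exp (- (n * decay \<theta>)) * \<theta>"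
      if "0 \<le> \<theta>" "\<theta> \<le> pi" for \<theta>
    proof -
      have "slope \<theta> \<le> 1"
        unfolding slope_def by (simp add: divide_le_eq_1 order.trans[OF cos_le_one cosh_real_ge_1])
      then show ?thesis using slope_bounds[OF that] by (simp add: abs_mult)
    qed
    then show ?thesis using abs_integral_le_moment[OF n I1[unfolded N_def]] by (auto simp: N_def)
  qed
  let ?G = "\<lambda>\<theta>. - (exp (- (N * decay \<theta>)) / N)"
  have I2: "((\<lambda>\<theta>. exp (- (N * decay \<theta>)) * slope \<theta>) has_integral (?G pi - ?G 0)) {0..pi}"
  proof (rule fundamental_theorem_of_calculus)
    fix \<theta> :: real assume "\<theta> \<in> {0..pi}"
    show "(?G has_vector_derivative exp (- (N * decay \<theta>)) * slope \<theta>) (at \<theta> within {0..pi})"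
      unfolding has_real_derivative_iff_has_vector_derivative[symmetric]
      using N by (auto intro!: derivative_eq_intros has_real_derivative_decay)
  qed simp
  let ?H = "\<lambda>\<theta>. - (exp (- (N * \<theta>)) / N)"
  have I3: "((\<lambda>\<theta>. exp (- (N * \<theta>))) has_integral (?H pi - ?H 0)) {0..pi}"
  proof (rule fundamental_theorem_of_calculus)
    fix \<theta> :: real assume "\<theta> \<in> {0..pi}"
    show "(?H has_vector_derivative exp (- (N * \<theta>))) (at \<theta> within {0..pi})"
      unfolding has_real_derivative_iff_has_vector_derivative[symmetric]
      using N by (auto intro!: derivative_eq_intros)
  qed simp
  have D: "(?D has_integral (I1 + (?G pi - ?G 0) - (?H pi - ?H 0))) {0..pi}"
  proof (rule has_integral_eq)
    show "((\<lambda>\<theta>. exp (- (N * decay \<theta>)) * (1 - slope \<theta>) + exp (- (N * decay \<theta>)) * slope \<theta> - exp (- (N * \<theta>)))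
        has_integral (I1 + (?G pi - ?G 0) - (?H pi - ?H 0))) {0..pi}"
      by (intro has_integral_add has_integral_diff I1 I2 I3)
  qed (simp add: algebra_simps)
  have "exp (- (N * pi)) \<le> exp (- (N * decay pi))"
    using decay_le[of pi] N by (simp add: mult_left_mono)
  then have "exp (- (N * pi)) / N \<le> exp (- (N * decay pi)) / N"
    using N by (intro divide_right_mono) auto
  moreover have "(?G pi - ?G 0) - (?H pi - ?H 0) = exp (- (N * pi)) / N - exp (- (N * decay pi)) / N"
    by simp
  ultimately have D_le: "I1 + (?G pi - ?G 0) - (?H pi - ?H 0) \<le> 16 / N\<^sup>2"
    using I1_le by linarith
  have "((\<lambda>\<theta>. exp (- (N * decay \<theta>)) * cos (M * \<theta>) - exp (- (N * \<theta>)) * cos (M * \<theta>)) has_integral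
      (decay_cos m n - (?F pi - ?F 0))) {0..pi}"
    using has_integral_decay_cos[of n m] exact unfolding N_def M_def by (intro has_integral_diff)
  then have "\<bar>decay_cos m n - (?F pi - ?F 0)\<bar> \<le> I1 + (?G pi - ?G 0) - (?H pi - ?H 0)"
  proof (rule abs_has_integral_le[OF _ D])
    fix \<theta> :: real assume \<theta>: "\<theta> \<in> {0..pi}"
    have "exp (- (N * \<theta>)) \<le> exp (- (N * decay \<theta>))"
      using decay_le[of \<theta>] N \<theta> by (simp add: mult_left_mono)
    then have "\<bar>?D \<theta>\<bar> * \<bar>cos (M * \<theta>)\<bar> \<le> ?D \<theta> * 1"
      by (intro mult_mono) auto
    then show "\<bar>exp (- (N * decay \<theta>)) * cos (M * \<theta>) - exp (- (N * \<theta>)) * cos (M * \<theta>)\<bar> \<le> ?D \<theta>"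
      by (simp add: left_diff_distrib[symmetric] abs_mult)
  qed
  then have "\<bar>decay_cos m n - (?F pi - ?F 0)\<bar> \<le> 16 / N\<^sup>2" using D_le by simp
  moreover have "\<bar>x - q\<bar> \<le> b + c" if "\<bar>x - (p - - q)\<bar> \<le> b" "\<bar>p\<bar> \<le> c" for x p q b c :: real
    using that by linarith
  ultimately have "\<bar>decay_cos m n - N / (N\<^sup>2 + M\<^sup>2)\<bar> \<le> 16 / N\<^sup>2 + 1 / N\<^sup>2"
    using Fpi unfolding F0 by blast
  then show ?thesis by (simp add: N_def M_def)
qed

section \<open>The squared gradient in a cone\<close>

text \<open>
  In the squares of the four differences the mixed terms of the two integrals cancel in opposite
  pairs.
\<close>

lemma gradient_square_sum:
  assumes "1 \<le> n"
  shows "(\<Sum>y | enorm ((m, n) - y) = 1. (potential_kernel y - potential_kernel (m, n))\<^sup>2)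
    = 8 / pi\<^sup>2 * ((decay_cos m n)\<^sup>2 * (1 + (m / n)\<^sup>2) + 2 * (decay_cos_tanh m n)\<^sup>2)"
proof -
  define A B q where "A = decay_cos m n" and "B = decay_cos_tanh m n" and "q = real_of_int m / real_of_int n"
  have "(\<Sum>y | enorm ((m, n) - y) = 1. (potential_kernel y - potential_kernel (m, n))\<^sup>2)
     = (2 / pi * (q * A + B))\<^sup>2 + (2 / pi * (- (q * A) + B))\<^sup>2
       + (2 / pi * (A - B))\<^sup>2 + (2 / pi * (- A - B))\<^sup>2"
    unfolding sum_neighbours A_def B_def q_def decay_sin_slope_eq[OF assms, symmetric]
    using assms by (simp add: potential_kernel_up potential_kernel_down potential_kernel_left potential_kernel_right)
  also have "\<dots> = (2 / pi)\<^sup>2 * ((q * A + B)\<^sup>2 + (- (q * A) + B)\<^sup>2 + (A - B)\<^sup>2 + (- A - B)\<^sup>2)"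
    by (simp only: power_mult_distrib distrib_left[of "(2 / pi)\<^sup>2"])
  also have "(q * A + B)\<^sup>2 + (- (q * A) + B)\<^sup>2 + (A - B)\<^sup>2 + (- A - B)\<^sup>2 = 2 * (A\<^sup>2 * (1 + q\<^sup>2) + 2 * B\<^sup>2)"
    by (simp add: power2_eq_square algebra_simps)
  also have "(2 / pi)\<^sup>2 * (2 * (A\<^sup>2 * (1 + q\<^sup>2) + 2 * B\<^sup>2)) = 8 / pi\<^sup>2 * (A\<^sup>2 * (1 + q\<^sup>2) + 2 * B\<^sup>2)"
    by (simp add: power_divide)
  finally show ?thesis by (simp only: A_def B_def q_def)
qed

lemma neighbour_sum_harmonic:
  assumes "1 \<le> n"
  shows "(\<Sum>y | enorm ((m, n) - y) = 1. potential_kernel y) = 4 * potential_kernel (m, n)"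
proof -
  have "(potential_kernel (m + 1, n) - potential_kernel (m, n)) + (potential_kernel (m - 1, n) - potential_kernel (m, n))
      + (potential_kernel (m, n + 1) - potential_kernel (m, n)) + (potential_kernel (m, n - 1) - potential_kernel (m, n)) = 0"
    using assms by (simp add: potential_kernel_up potential_kernel_down potential_kernel_left potential_kernel_right)
      (simp add: add_divide_distrib diff_divide_distrib)
  then show ?thesis unfolding sum_neighbours by simp
qed

text \<open>
  The leading part \<open>n / (n\<^sup>2 + m\<^sup>2)\<close> of the first integral contributes exactly \<open>1 / (n\<^sup>2 + m\<^sup>2)\<close>; all
  other terms contain one of the errors of order \<open>1 / n\<^sup>2\<close>. The constant is not optimised.
\<close>

lemma gradient_square_sum_cone:
  assumes n: "1 \<le> n" and m: "\<bar>m\<bar> \<le> n"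
  shows "\<bar>(\<Sum>y | enorm ((m, n) - y) = 1. (potential_kernel y - potential_kernel (m, n))\<^sup>2)
      - 8 / pi\<^sup>2 / (enorm (m, n))\<^sup>2\<bar> \<le> 1400 / (real_of_int n) ^ 3"
proof -
  define N M where "N = real_of_int n" and "M = real_of_int m"
  have N: "1 \<le> N" "\<bar>M\<bar> \<le> N" using n m by (simp_all add: N_def M_def)
  have rr: "0 < N\<^sup>2 + M\<^sup>2" using N by (simp add: add_pos_nonneg)
  define A0 d B where "A0 = N / (N\<^sup>2 + M\<^sup>2)" and "d = decay_cos m n - A0" and "B = decay_cos_tanh m n"
  have d: "\<bar>d\<bar> \<le> 17 / N\<^sup>2" using decay_cos_bound[OF n, of m] by (simp add: d_def A0_def N_def M_def)
  have B: "\<bar>B\<bar> \<le> 16 / N\<^sup>2" using decay_cos_tanh_bound[OF n, of m] by (simp add: B_def N_def)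
  have q: "1 + (M / N)\<^sup>2 \<le> 2" "0 \<le> 1 + (M / N)\<^sup>2"
    using N abs_le_square_iff[of M N] by (simp_all add: power_divide divide_le_eq_1)
  have A0: "0 \<le> A0" "A0 \<le> 1 / N"
  proof -
    show "0 \<le> A0" using N by (simp add: A0_def)
    have "A0 \<le> N / N\<^sup>2" unfolding A0_def using N by (intro divide_left_mono) (auto simp: add_pos_nonneg)
    then show "A0 \<le> 1 / N" using N by (simp add: power2_eq_square)
  qed
  \<comment> \<open>The leading terms match exactly; this is the squared gradient of the logarithm.\<close>
  have main: "A0\<^sup>2 * (1 + (M / N)\<^sup>2) = 1 / (N\<^sup>2 + M\<^sup>2)"
  proof -
    have "1 + (M / N)\<^sup>2 = (N\<^sup>2 + M\<^sup>2) / N\<^sup>2" using N by (simp add: field_simps)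
    then show ?thesis using N rr by (simp add: A0_def power_divide power2_eq_square[of "N\<^sup>2 + M\<^sup>2"])
  qed
  have e: "(A0 + d)\<^sup>2 * (1 + (M / N)\<^sup>2) + 2 * B\<^sup>2 - 1 / (N\<^sup>2 + M\<^sup>2)
      = (2 * A0 + d) * d * (1 + (M / N)\<^sup>2) + 2 * B\<^sup>2"
    unfolding main[symmetric] by (simp add: power2_eq_square algebra_simps)
  have "\<bar>2 * A0 + d\<bar> \<le> 19 / N"
  proof -
    have "17 / N\<^sup>2 \<le> 17 / N" using N by (intro divide_left_mono) (auto simp: power2_eq_square)
    then show ?thesis using A0 d by (simp add: abs_le_iff)
  qed
  then have "\<bar>(2 * A0 + d) * d * (1 + (M / N)\<^sup>2)\<bar> \<le> 19 / N * (17 / N\<^sup>2) * 2"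
    unfolding abs_mult using d q N by (intro mult_mono) auto
  moreover have "19 / N * (17 / N\<^sup>2) * 2 = 646 / N ^ 3" by (simp add: power2_eq_square power3_eq_cube)
  moreover have "2 * B\<^sup>2 \<le> 512 / N ^ 3"
  proof -
    have "B\<^sup>2 \<le> (16 / N\<^sup>2)\<^sup>2" using B by (metis abs_ge_zero power2_abs power_mono)
    also have "\<dots> = 256 / N ^ 4" by (simp add: power_divide)
    also have "\<dots> \<le> 256 / N ^ 3" using N by (intro divide_left_mono power_increasing) auto
    finally show ?thesis by simp
  qed
  ultimately have bound: "\<bar>(A0 + d)\<^sup>2 * (1 + (M / N)\<^sup>2) + 2 * B\<^sup>2 - 1 / (N\<^sup>2 + M\<^sup>2)\<bar> \<le> 1400 / N ^ 3"
  proof -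
    have "\<bar>u + v\<bar> \<le> 1400 / N ^ 3" if "\<bar>u\<bar> \<le> 646 / N ^ 3" "v \<le> 512 / N ^ 3" "0 \<le> v" for u v
    proof -
      have "646 / N ^ 3 + 512 / N ^ 3 \<le> 1400 / N ^ 3" using N by (simp add: add_divide_distrib[symmetric] divide_right_mono)
      then show ?thesis using that by linarith
    qed
    then show ?thesis unfolding e
      using \<open>\<bar>(2 * A0 + d) * d * (1 + (M / N)\<^sup>2)\<bar> \<le> 19 / N * (17 / N\<^sup>2) * 2\<close>
        \<open>19 / N * (17 / N\<^sup>2) * 2 = 646 / N ^ 3\<close> \<open>2 * B\<^sup>2 \<le> 512 / N ^ 3\<close> by simp
  qed
  have "8 \<le> pi * pi"
    using mult_mono[of 3 pi 3 pi] pi_gt3 by simp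
  then have pi8: "0 \<le> 8 / pi\<^sup>2" "8 / pi\<^sup>2 \<le> 1" by (simp_all add: power2_eq_square divide_le_eq_1)
  have r: "(enorm (m, n))\<^sup>2 = N\<^sup>2 + M\<^sup>2" by (simp add: enorm_sq N_def M_def)
  have "(\<Sum>y | enorm ((m, n) - y) = 1. (potential_kernel y - potential_kernel (m, n))\<^sup>2) - 8 / pi\<^sup>2 / (enorm (m, n))\<^sup>2
     = 8 / pi\<^sup>2 * ((A0 + d)\<^sup>2 * (1 + (M / N)\<^sup>2) + 2 * B\<^sup>2 - 1 / (N\<^sup>2 + M\<^sup>2))"
    unfolding gradient_square_sum[OF n] r
    by (simp add: d_def B_def N_def M_def diff_divide_distrib right_diff_distrib)
  then have "\<bar>(\<Sum>y | enorm ((m, n) - y) = 1. (potential_kernel y - potential_kernel (m, n))\<^sup>2) - 8 / pi\<^sup>2 / (enorm (m, n))\<^sup>2\<bar>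
     = 8 / pi\<^sup>2 * \<bar>(A0 + d)\<^sup>2 * (1 + (M / N)\<^sup>2) + 2 * B\<^sup>2 - 1 / (N\<^sup>2 + M\<^sup>2)\<bar>"
    using pi8(1) by (simp only: abs_mult abs_of_nonneg)
  also have "\<dots> \<le> 1 * (1400 / N ^ 3)"
    using pi8 bound by (intro mult_mono) auto
  finally show ?thesis by (simp add: N_def)
qed

section \<open>Values of the potential kernel\<close>

lemma potential_kernel_origin: "potential_kernel 0 = 0"
proof -
  have "profile 0 = (\<lambda>_. 0)" by (auto simp: profile_def)
  then show ?thesis using has_integral_unique[OF potential_kernel_integral[of 0], of 0] by simp
qed

lemma potential_kernel_nonneg: "0 \<le> potential_kernel x"
proof -
  have "0 \<le> pi / 2 * potential_kernel x"
  proof (rule has_integral_nonneg[OF potential_kernel_integral])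
    fix \<theta> :: real assume \<theta>: "\<theta> \<in> {0..pi}"
    have s: "0 \<le> decay \<theta>" using \<theta> by (intro decay_nonneg) auto
    have "\<bar>cos (real_of_int (fst x) * \<theta>) * exp (- (\<bar>real_of_int (snd x)\<bar> * decay \<theta>))\<bar> \<le> 1 * 1"
      unfolding abs_mult using s by (intro mult_mono) auto
    then have "0 \<le> 1 - cos (real_of_int (fst x) * \<theta>) * exp (- (\<bar>real_of_int (snd x)\<bar> * decay \<theta>))"
      by linarith
    then show "0 \<le> profile x \<theta>" using s by (simp add: profile_def)
  qed
  then have "pi / 2 * 0 \<le> pi / 2 * potential_kernel x" by simp
  then show ?thesis by (subst (asm) mult_le_cancel_left_pos) auto
qed

text \<open>
  The difference integrals at the origin give \<open>a (0, 1) + a (1, 0) = 2\<close>, and both values agree by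
  symmetry.
\<close>

lemma potential_kernel_unit:
  assumes "enorm x = 1"
  shows "potential_kernel x = 1"
proof -
  have A: "decay_cos 0 0 = pi"
    using integral_const_real[of "1 :: real" 0 pi] by (simp add: decay_cos_def)
  have "potential_kernel (0, 1) = 2 / pi * (decay_cos 0 0 - decay_cos_tanh 0 0)"
    using potential_kernel_up[of 0 0] potential_kernel_origin by (simp add: zero_prod_def)
  moreover have "potential_kernel (1, 0) = 2 / pi * decay_cos_tanh 0 0"
    using potential_kernel_right[of 0 0] potential_kernel_origin by (simp add: zero_prod_def decay_sin_slope_def)
  ultimately have "potential_kernel (0, 1) + potential_kernel (1, 0) = 2"
    unfolding A by (simp add: right_diff_distrib)
  then have "potential_kernel (0, 1) = 1" "potential_kernel (1, 0) = 1"
    using potential_kernel_swap[of 0 1] by simp_all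
  then show ?thesis
    using assms potential_kernel_reflect(1)[of 1 0] potential_kernel_reflect(2)[of 0 1]
    by (auto simp: enorm_eq_1_iff steps_def)
qed

text \<open>
  The integrand is the derivative of a multiple of \<open>exp (- k * decay \<theta>) * cos (k \<theta>)\<close> with
  \<open>k = n + 1 / 2\<close>, which vanishes at \<open>\<theta> = pi\<close>.
\<close>

lemma diagonal_integral:
  fixes n :: nat
  shows "((\<lambda>\<theta>. exp (- ((n + 1/2) * decay \<theta>)) * (slope \<theta> * cos ((n + 1/2) * \<theta>) + sin ((n + 1/2) * \<theta>)))
      has_integral (2 / (2 * n + 1))) {0..pi}"
proof -
  define k where "k = real n + 1/2"
  have k: "0 < k" by (simp add: k_def)
  let ?F = "\<lambda>\<theta>. - (exp (- (k * decay \<theta>)) * cos (k * \<theta>)) / k"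
  have "((\<lambda>\<theta>. exp (- (k * decay \<theta>)) * (slope \<theta> * cos (k * \<theta>) + sin (k * \<theta>)))
      has_integral (?F pi - ?F 0)) {0..pi}"
  proof (rule fundamental_theorem_of_calculus)
    fix \<theta> :: real assume "\<theta> \<in> {0..pi}"
    show "(?F has_vector_derivative exp (- (k * decay \<theta>)) * (slope \<theta> * cos (k * \<theta>) + sin (k * \<theta>)))
        (at \<theta> within {0..pi})"
      unfolding has_real_derivative_iff_has_vector_derivative[symmetric]
      using k by (auto intro!: derivative_eq_intros has_real_derivative_decay simp: field_simps)
  qed simp
  moreover have "cos (k * pi) = 0"
  proof -
    have "cos (k * pi) = cos (n * pi + pi / 2)" by (simp add: k_def algebra_simps)
    also have "\<dots> = 0" by (simp add: cos_add)
    finally show ?thesis .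
  qed
  moreover have "1 / k = 2 / (2 * n + 1)" by (simp add: k_def field_simps)
  ultimately show ?thesis by (simp add: k_def)
qed

text \<open>
  Centre both exponents and both angles at \<open>n + 1 / 2\<close>. What remains are functions of half
  arguments, where \<open>sinh (decay \<theta> / 2) = sin (\<theta> / 2)\<close> makes the quotient collapse.
\<close>

lemma profile_diagonal:
  fixes n :: nat
  assumes "0 < \<theta>" "\<theta> \<le> pi"
  shows "profile (int n + 1, int n + 1) \<theta> - profile (int n, int n) \<theta>
     = exp (- ((n + 1/2) * decay \<theta>)) * (slope \<theta> * cos ((n + 1/2) * \<theta>) + sin ((n + 1/2) * \<theta>))"
proof -
  define s h a where "s = decay \<theta>" and "h = \<theta> / 2" and "a = (n + 1/2) * \<theta>"
  have s: "0 < s" using decay_pos[OF assms] by (simp add: s_def)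
  define S C where "S = sinh (s / 2)" and "C = cosh (s / 2)"
  have pos: "0 < S" "0 < C" using s by (simp_all add: S_def C_def)
  have sinh: "sinh s = 2 * S * C" using sinh_double[of "s / 2"] by (simp add: S_def C_def)
  have Sh: "S = sin h" by (simp add: S_def s_def h_def sinh_half_decay)
  have EC: "exp (s / 2) = C + S" "exp (- (s / 2)) = C - S"
    using cosh_plus_sinh[of "s / 2"] cosh_minus_sinh[of "s / 2"] by (simp_all add: C_def S_def)
  define g where "g = exp (- ((n + 1/2) * s))"
  have g: "exp (- (n * s)) = g * (C + S)" "exp (- ((n + 1) * s)) = g * (C - S)"
    unfolding g_def EC[symmetric] by (simp_all add: exp_add[symmetric] algebra_simps)
  have cos1: "cos (n * \<theta>) = cos a * cos h + sin a * sin h"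
    using cos_diff[of a h] by (simp add: a_def h_def algebra_simps)
  have cos2: "cos ((n + 1) * \<theta>) = cos a * cos h - sin a * sin h"
    using cos_add[of a h] by (simp add: a_def h_def algebra_simps)
  have "profile (int n + 1, int n + 1) \<theta> - profile (int n, int n) \<theta>
     = (cos (n * \<theta>) * exp (- (n * s)) - cos ((n + 1) * \<theta>) * exp (- ((n + 1) * s))) / sinh s"
    by (simp add: profile_def s_def diff_divide_distrib add.commute)
  also have "\<dots> = g * ((cos a * cos h + sin a * sin h) * (C + S) - (cos a * cos h - sin a * sin h) * (C - S)) / (2 * S * C)"
    unfolding g cos1 cos2 sinh by (simp add: algebra_simps)
  also have "(cos a * cos h + sin a * sin h) * (C + S) - (cos a * cos h - sin a * sin h) * (C - S)
      = 2 * S * (cos a * cos h) + 2 * S * C * sin a"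
    by (simp add: Sh algebra_simps)
  also have "g * (2 * S * (cos a * cos h) + 2 * S * C * sin a) / (2 * S * C) = g * (cos h / C * cos a + sin a)"
    using pos by (simp add: field_simps)
  also have "cos h / C = slope \<theta>" by (simp add: slope_def h_def C_def s_def)
  finally show ?thesis by (simp add: g_def a_def s_def)
qed

lemma potential_kernel_diagonal_step:
  fixes n :: nat
  shows "potential_kernel (int n + 1, int n + 1) - potential_kernel (int n, int n) = 4 / pi * (1 / (2 * n + 1))"
  using potential_kernel_diff[OF diagonal_integral profile_diagonal, of n] by simp

text \<open>
  The increments along the diagonal are \<open>4 / pi\<close> times the reciprocals of the odd numbers; their sum
  is a combination of harmonic numbers.
\<close>

lemma potential_kernel_diagonal:
  fixes n :: nat
  shows "potential_kernel (int n, int n) = 4 / pi * (harm (2 * n) - harm n / 2)"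
proof (induction n)
  case 0
  then show ?case using potential_kernel_origin by (simp add: harm_def zero_prod_def)
next
  case (Suc n)
  have even: "harm (2 * Suc n) = harm (2 * n) + 1 / (2 * real n + 1) + 1 / (2 * (real n + 1))"
    by (simp add: harm_Suc inverse_eq_divide add_ac)
  have "harm (Suc n) / 2 = harm n / 2 + 1 / (2 * (real n + 1))"
    by (simp add: harm_Suc inverse_eq_divide add_divide_distrib add_ac mult.commute)
  then have "harm (2 * Suc n) - harm (Suc n) / 2 = harm (2 * n) - harm n / 2 + 1 / (2 * real n + 1)"
    unfolding even by (simp only: add_diff_eq diff_add_eq add_diff_cancel_right')
  then show ?case using Suc potential_kernel_diagonal_step[of n] by (simp add: distrib_left add.commute)
qed

section \<open>Logarithmic asymptotics in a cone\<close>

lemma harm_bound: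
  assumes "1 \<le> n"
  shows "\<bar>harm n - ln (real n) - euler_mascheroni\<bar> \<le> 1 / real n"
proof -
  obtain k where k: "n = Suc k" using assms by (cases n) auto
  have n: "0 < real n" using assms by simp
  \<comment> \<open>The known bounds compare with ln (n + 1), hence the shift of the logarithm below.\<close>
  have lower: "harm n - ln (real n + 1) \<le> euler_mascheroni"
    and upper: "euler_mascheroni \<le> harm n - ln (real n + 1) + 1 / (2 * real n)"
    using euler_mascheroni_lower[of k] euler_mascheroni_upper[of k] by (auto simp: k algebra_simps)
       (smt (verit) divide_nonneg_nonneg of_nat_0_le_iff)
  have "ln (real n + 1) - ln (real n) = ln (1 + 1 / real n)"
    using n ln_div[of "real n + 1" "real n"] by (simp add: add_divide_distrib)
  moreover have "ln (1 + 1 / real n) \<le> 1 / real n" "0 \<le> ln (1 + 1 / real n)"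
    using n by (auto intro!: ln_add_one_self_le_self)
  moreover have "1 / (2 * real n) \<le> 1 / real n" using n by (simp add: field_simps)
  ultimately show ?thesis using lower upper by (intro abs_leI) linarith+
qed

definition kernel_const :: real where
  "kernel_const = euler_mascheroni + ln 8 / 2"

lemma enorm_pos: "x \<noteq> 0 \<Longrightarrow> 0 < enorm x"
  using enorm_sq[of x] enorm_nonneg[of x]
  by (cases x) (auto simp: zero_prod_def less_le)

lemma ln_enorm:
  assumes "x \<noteq> 0"
  shows "2 * ln (enorm x) = ln ((real_of_int (fst x))\<^sup>2 + (real_of_int (snd x))\<^sup>2)"
  using enorm_pos[OF assms] unfolding enorm_sq[symmetric] by (simp add: ln_realpow)

lemma potential_kernel_diagonal_asymp:
  assumes "1 \<le> n"
  shows "\<bar>potential_kernel (int n, int n) - 2 / pi * (ln (enorm (int n, int n)) + kernel_const)\<bar> \<le> 2 / real n"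
proof -
  define L where "L = ln (real n)"
  have n: "0 < real n" using assms by simp
  have nz: "(int n, int n) \<noteq> 0" using assms by (simp add: zero_prod_def)
  have "2 * ln (enorm (int n, int n)) = ln (2 * (real n)\<^sup>2)" using ln_enorm[OF nz] by simp
  also have "\<dots> = ln 2 + 2 * L" using n by (simp add: ln_mult ln_realpow L_def)
  finally have r: "ln (enorm (int n, int n)) = ln 2 / 2 + L" by simp
  have ln8: "ln 8 = 3 * ln (2 :: real)" using ln_realpow[of 2 3] by simp
  define e1 e2 where "e1 = harm (2 * n) - ln (real (2 * n)) - euler_mascheroni"
    and "e2 = harm n - ln (real n) - euler_mascheroni"
  have e: "\<bar>e1\<bar> \<le> 1 / (2 * real n)" "\<bar>e2\<bar> \<le> 1 / real n"
    using harm_bound[of "2 * n"] harm_bound[of n] assms by (simp_all add: e1_def e2_def)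
  have "ln (real (2 * n)) = ln 2 + L" using n by (simp add: ln_mult L_def)
  then have "harm (2 * n) - harm n / 2 = (ln 2 / 2 + L + kernel_const) / 2 + (e1 - e2 / 2)"
    by (simp add: e1_def e2_def L_def[symmetric] kernel_const_def ln8 field_simps)
  then have "potential_kernel (int n, int n) - 2 / pi * (ln (enorm (int n, int n)) + kernel_const)
      = 4 / pi * (e1 - e2 / 2)"
  proof -
    have "4 / pi * (v / 2 + d) - 2 / pi * v = 4 / pi * d" for v d :: real
      by (simp add: field_simps)
    then show ?thesis
      unfolding potential_kernel_diagonal r \<open>harm (2 * n) - harm n / 2 = _\<close> .
  qed
  also have "\<bar>4 / pi * (e1 - e2 / 2)\<bar> \<le> 2 * (1 / real n)"
    unfolding abs_mult
  proof (intro mult_mono)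
    have "2 \<le> pi" using pi_gt3 by simp
    then show "\<bar>4 / pi\<bar> \<le> 2" by (simp add: field_simps)
    show "\<bar>e1 - e2 / 2\<bar> \<le> 1 / real n"
      using e abs_triangle_ineq4[of e1 "e2 / 2"] by simp
  qed auto
  finally show ?thesis by simp
qed

lemma telescoping_bound:
  fixes f :: "nat \<Rightarrow> real"
  assumes "m \<le> n" and "\<And>k. m \<le> k \<Longrightarrow> k < n \<Longrightarrow> \<bar>f (Suc k) - f k\<bar> \<le> c"
  shows "\<bar>f n - f m\<bar> \<le> real (n - m) * c"
  using assms
proof (induction n rule: dec_induct)
  case (step n)
  have "\<bar>f n - f m\<bar> \<le> real (n - m) * c" using step.IH step.prems by simp
  moreover have "\<bar>f (Suc n) - f n\<bar> \<le> c" using step.prems[of n] step.hyps by simp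
  ultimately have "\<bar>f (Suc n) - f m\<bar> \<le> real (n - m) * c + c" by linarith
  also have "\<dots> = real (Suc n - m) * c" using step.hyps by (simp add: Suc_diff_le algebra_simps)
  finally show ?case .
qed simp

text \<open>
  Both terms of \<open>F\<close> grow by \<open>2 / pi * k / (n\<^sup>2 + k\<^sup>2)\<close> per step, up to order \<open>1 / n\<^sup>2\<close>. At most \<open>n\<close>
  such steps lead to the diagonal, with a total error of order \<open>1 / n\<close>.
\<close>

lemma horizontal_step:
  fixes k n :: nat
  assumes "k < n"
  defines "F \<equiv> \<lambda>k. potential_kernel (int k, int n) - 2 / pi * ln (enorm (int k, int n))"
  shows "\<bar>F (Suc k) - F k\<bar> \<le> 40 / (real n)\<^sup>2"
proof -
  define N x where "N = real n" and "x = real k"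
  have N: "1 \<le> N" "0 \<le> x" "x \<le> N - 1" using assms(1) by (simp_all add: N_def x_def)
  define R where "R = N\<^sup>2 + x\<^sup>2"
  have NR: "N\<^sup>2 \<le> R" by (simp add: R_def)
  have N2: "0 < N\<^sup>2" using N by simp
  then have R: "0 < R" using NR by linarith
  define A B where "A = decay_cos (int k) (int n)" and "B = decay_cos_tanh (int k) (int n)"
  have n1: "1 \<le> int n" using assms(1) by simp
  have A: "\<bar>A - N / R\<bar> \<le> 17 / N\<^sup>2"
    using decay_cos_bound[OF n1, of "int k"] by (simp add: A_def N_def R_def x_def)
  have B: "\<bar>B\<bar> \<le> 16 / N\<^sup>2" using decay_cos_tanh_bound[OF n1, of "int k"] by (simp add: B_def N_def)
  have "potential_kernel (int (Suc k), int n) - potential_kernel (int k, int n) = 2 / pi * (x / N * A + B)"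
    using potential_kernel_right[of "int n" "int k"] decay_sin_slope_eq[OF n1, of "int k"] n1
    by (simp add: A_def B_def N_def x_def add.commute)
  moreover have "2 * ln (enorm (int (Suc k), int n)) - 2 * ln (enorm (int k, int n)) = ln (1 + (2 * x + 1) / R)"
  proof -
    have "(int (Suc k), int n) \<noteq> 0" "(int k, int n) \<noteq> 0" using n1 by (auto simp: zero_prod_def)
    from this[THEN ln_enorm]
    have "2 * ln (enorm (int (Suc k), int n)) - 2 * ln (enorm (int k, int n))
        = ln ((x + 1)\<^sup>2 + N\<^sup>2) - ln (x\<^sup>2 + N\<^sup>2)"
      by (simp add: x_def N_def add.commute)
    also have "(x + 1)\<^sup>2 + N\<^sup>2 = R + (2 * x + 1)" by (simp add: R_def power2_eq_square algebra_simps)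
    also have "ln (R + (2 * x + 1)) - ln (x\<^sup>2 + N\<^sup>2) = ln ((R + (2 * x + 1)) / R)"
      using R N by (subst ln_div) (auto simp: R_def add.commute)
    also have "(R + (2 * x + 1)) / R = 1 + (2 * x + 1) / R" using R by (simp add: add_divide_distrib)
    finally show ?thesis .
  qed
  ultimately have diff: "F (Suc k) - F k = 2 / pi * ((x / N * A + B) - ln (1 + (2 * x + 1) / R) / 2)"
    unfolding F_def by (simp add: right_diff_distrib) (simp add: field_simps)
  define u where "u = (2 * x + 1) / R"
  have u: "0 \<le> u" "u \<le> 2 / N" "u \<le> 1"
  proof -
    show "0 \<le> u" using N R by (simp add: u_def)
    have "u \<le> (2 * N) / N\<^sup>2" unfolding u_def using N NR N2 by (intro frac_le) auto
    then show "u \<le> 2 / N" using N by (simp add: power2_eq_square)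
    have "0 \<le> (N - 1)\<^sup>2" by simp
    then have "2 * x + 1 \<le> N\<^sup>2" using N by (simp add: power2_eq_square algebra_simps)
    then have "2 * x + 1 \<le> R" using NR by linarith
    then show "u \<le> 1" using R by (simp add: u_def)
  qed
  have "\<bar>ln (1 + u) - u\<bar> \<le> u\<^sup>2"
    using u by (intro abs_ln_one_plus_x_minus_x_bound_nonneg) auto
  also have "\<dots> \<le> (2 / N)\<^sup>2" using u by (intro power_mono) auto
  finally have l1: "\<bar>ln (1 + u) - u\<bar> \<le> 4 * (1 / N\<^sup>2)" by (simp add: power_divide)
  have l2: "u / 2 - x / R = 1 / R / 2" by (simp add: u_def add_divide_distrib)
  have l3: "0 \<le> 1 / R" "1 / R \<le> 1 / N\<^sup>2" using R frac_le[OF _ _ N2 NR, of 1 1] by simp_all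
  have "x / N * A - x / R = x / N * (A - N / R)" using N by (simp add: right_diff_distrib)
  then have "\<bar>x / N * A - x / R\<bar> = (x / N) * \<bar>A - N / R\<bar>" using N by (simp add: abs_mult)
  also have "\<dots> \<le> 1 * (17 / N\<^sup>2)" using N A by (intro mult_mono) auto
  finally have l4: "\<bar>x / N * A - x / R\<bar> \<le> 17 * (1 / N\<^sup>2)" by simp
  have l5: "\<bar>B\<bar> \<le> 16 * (1 / N\<^sup>2)" using B by simp
  have sum: "\<bar>(p + b) - l / 2\<bar> \<le> 40 * c"
    if "\<bar>l - v\<bar> \<le> 4 * c" "v / 2 - z = w / 2" "0 \<le> w" "w \<le> c" "\<bar>p - z\<bar> \<le> 17 * c" "\<bar>b\<bar> \<le> 16 * c"
    for l v z w p b c :: real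
    using that unfolding abs_le_iff by linarith
  have "\<bar>(x / N * A + B) - ln (1 + u) / 2\<bar> \<le> 40 * (1 / N\<^sup>2)"
    by (rule sum[OF l1 l2 l3 l4 l5])
  moreover have "\<bar>2 / pi\<bar> \<le> 1" using pi_gt3 by simp
  ultimately have "\<bar>F (Suc k) - F k\<bar> \<le> 1 * (40 * (1 / N\<^sup>2))"
    unfolding diff u_def[symmetric] abs_mult by (intro mult_mono) auto
  then show ?thesis by (simp add: N_def)
qed

lemma potential_kernel_asymp_cone:
  assumes n: "1 \<le> n" and m: "\<bar>m\<bar> \<le> n"
  shows "\<bar>potential_kernel (m, n) - 2 / pi * (ln (enorm (m, n)) + kernel_const)\<bar> \<le> 42 / real_of_int n"
proof -
  define j k where "j = nat \<bar>m\<bar>" and "k = nat n"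
  have jk: "int j = \<bar>m\<bar>" "int k = n" "j \<le> k" "1 \<le> k" using n m by (auto simp: j_def k_def)
  define F where "F i = potential_kernel (int i, int k) - 2 / pi * ln (enorm (int i, int k))" for i
  have "\<bar>F k - F j\<bar> \<le> real (k - j) * (40 / (real k)\<^sup>2)"
    unfolding F_def by (intro telescoping_bound jk horizontal_step)
  also have "\<dots> \<le> real k * (40 / (real k)\<^sup>2)" by (intro mult_right_mono) auto
  also have "\<dots> = 40 / real k" using jk by (simp add: power2_eq_square)
  finally have "\<bar>F k - F j\<bar> \<le> 40 / real k" .
  moreover have "\<bar>F k - 2 / pi * kernel_const\<bar> \<le> 2 / real k"
    using potential_kernel_diagonal_asymp[OF jk(4)] by (simp add: F_def distrib_left algebra_simps)
  ultimately have "\<bar>F j - 2 / pi * kernel_const\<bar> \<le> 40 / real k + 2 / real k" by linarith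
  moreover have "potential_kernel (int j, int k) = potential_kernel (m, n)"
    using potential_kernel_reflect(1)[of m n] jk by (cases "0 \<le> m") auto
  moreover have "enorm (int j, int k) = enorm (m, n)"
    using jk by (simp add: enorm_def real_point_def norm_Pair)
  moreover have "real k = real_of_int n" using jk by simp
  ultimately show ?thesis by (simp add: F_def distrib_left diff_diff_eq add_divide_distrib[symmetric])
qed

section \<open>Estimates in all directions\<close>

text \<open>
  Reflections and the swap of coordinates map every point into the cone \<open>\<bar>m\<bar> \<le> n\<close> and preserve the
  multiset of values of the kernel at the neighbours; sums of arbitrary functions \<open>h\<close> of these
  values express this.
\<close>

lemma cone_representative:
  assumes "x \<noteq> 0"
  shows "\<exists>m n. 1 \<le> n \<and> \<bar>m\<bar> \<le> n \<and> enorm x = enorm (m, n) \<and> potential_kernel x = potential_kernel (m, n) \<and>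
    (\<forall>h :: real \<Rightarrow> real. (\<Sum>y | enorm (x - y) = 1. h (potential_kernel y))
        = (\<Sum>y | enorm ((m, n) - y) = 1. h (potential_kernel y)))"
proof -
  obtain p q where x: "x = (p, q)" by (cases x)
  have swap: "(\<Sum>y | enorm ((a, b) - y) = 1. h (potential_kernel y))
      = (\<Sum>y | enorm ((b, a) - y) = 1. h (potential_kernel y))" for a b and h :: "real \<Rightarrow> real"
    unfolding sum_neighbours by (simp add: potential_kernel_swap[of a] potential_kernel_swap[of "a + 1"]
      potential_kernel_swap[of "a - 1"] )
  have flip: "(\<Sum>y | enorm ((a, - b) - y) = 1. h (potential_kernel y))
      = (\<Sum>y | enorm ((a, b) - y) = 1. h (potential_kernel y))" for a b and h :: "real \<Rightarrow> real"
  proof -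
    have "- b + 1 = - (b - 1)" "- b - 1 = - (b + 1)" by simp_all
    then show ?thesis
      unfolding sum_neighbours by (simp only: potential_kernel_reflect add_ac)
  qed
  have up: "(\<Sum>y | enorm ((a, \<bar>b\<bar>) - y) = 1. h (potential_kernel y))
      = (\<Sum>y | enorm ((a, b) - y) = 1. h (potential_kernel y))" for a b and h :: "real \<Rightarrow> real"
    using flip[where a=a and b=b and h=h] by (cases "0 \<le> b") simp_all
  have pk_up: "potential_kernel (a, \<bar>b\<bar>) = potential_kernel (a, b)" for a b
    using potential_kernel_reflect(2)[of a b] by (cases "0 \<le> b") simp_all
  have norm_up: "enorm (a, \<bar>b\<bar>) = enorm (a, b)" "enorm (a, b) = enorm (b, a)" for a b
    by (simp_all add: enorm_def real_point_def norm_Pair add.commute)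
  show ?thesis
  proof (cases "\<bar>p\<bar> \<le> \<bar>q\<bar>")
    case True
    then have "q \<noteq> 0" using assms by (auto simp: x zero_prod_def)
    show ?thesis
    proof (rule exI[of _ p], rule exI[of _ "\<bar>q\<bar>"], intro conjI allI)
      show "1 \<le> \<bar>q\<bar>" using \<open>q \<noteq> 0\<close> by simp
      show "\<bar>p\<bar> \<le> \<bar>q\<bar>" by (rule True)
    qed (simp_all only: x up pk_up norm_up(1))
  next
    case False
    show ?thesis
    proof (rule exI[of _ q], rule exI[of _ "\<bar>p\<bar>"], intro conjI allI)
      show "1 \<le> \<bar>p\<bar>" "\<bar>q\<bar> \<le> \<bar>p\<bar>" using False by simp_all
    qed (simp_all only: x up pk_up norm_up(1) swap[where a=p and b=q] potential_kernel_swap[of p q] norm_up(2)[of p q])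
  qed
qed

lemma inverse_le_enorm:
  fixes m n :: int
  assumes "1 \<le> n" "\<bar>m\<bar> \<le> n"
  shows "1 / real_of_int n \<le> 2 / enorm (m, n)"
proof -
  have "(enorm (m, n))\<^sup>2 \<le> (2 * real_of_int n)\<^sup>2"
  proof -
    have "(real_of_int m)\<^sup>2 \<le> (real_of_int n)\<^sup>2" using assms by (simp add: abs_le_square_iff[symmetric])
    also have "(real_of_int n)\<^sup>2 \<le> 3 * (real_of_int n)\<^sup>2" by simp
    finally show ?thesis unfolding enorm_sq power_mult_distrib by simp
  qed
  then have "enorm (m, n) \<le> 2 * real_of_int n" by (rule power2_le_imp_le) (use assms in simp)
  moreover have "(m, n) \<noteq> 0" using assms by (simp add: zero_prod_def)
  then have "0 < enorm (m, n)" by (rule enorm_pos)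
  ultimately show ?thesis using assms by (simp add: field_simps)
qed

lemma potential_kernel_asymp:
  assumes "x \<noteq> 0"
  shows "\<bar>potential_kernel x - 2 / pi * (ln (enorm x) + kernel_const)\<bar> \<le> 84 / enorm x"
proof -
  obtain m n where mn: "1 \<le> n" "\<bar>m\<bar> \<le> n" "enorm x = enorm (m, n)" "potential_kernel x = potential_kernel (m, n)"
    using cone_representative[OF assms] by (elim exE conjE) (rule that)
  show ?thesis
    using potential_kernel_asymp_cone[OF mn(1,2)] inverse_le_enorm[OF mn(1,2)] unfolding mn(3,4) by simp
qed

definition gradient_energy :: "lattice \<Rightarrow> real" where
  "gradient_energy x = (\<Sum>y | enorm (x - y) = 1. (potential_kernel y - potential_kernel x)\<^sup>2)"

lemma gradient_energy_asymp:
  assumes "x \<noteq> 0"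
  shows "\<bar>gradient_energy x - 8 / pi\<^sup>2 / (enorm x)\<^sup>2\<bar> \<le> 11200 / (enorm x) ^ 3"
proof -
  obtain m n where mn: "1 \<le> n" "\<bar>m\<bar> \<le> n" "enorm x = enorm (m, n)" "potential_kernel x = potential_kernel (m, n)"
    "\<forall>h :: real \<Rightarrow> real. (\<Sum>y | enorm (x - y) = 1. h (potential_kernel y))
        = (\<Sum>y | enorm ((m, n) - y) = 1. h (potential_kernel y))"
    using cone_representative[OF assms] by (elim exE conjE) (rule that)
  have "(1 / real_of_int n) ^ 3 \<le> (2 / enorm (m, n)) ^ 3"
    using inverse_le_enorm[OF mn(1,2)] mn(1) by (intro power_mono) auto
  then have n: "1400 / (real_of_int n) ^ 3 \<le> 11200 / (enorm (m, n)) ^ 3"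
    by (simp add: power_divide)
  have E: "gradient_energy x = (\<Sum>y | enorm ((m, n) - y) = 1. (potential_kernel y - potential_kernel (m, n))\<^sup>2)"
    unfolding gradient_energy_def mn(4) by (rule mn(5)[rule_format])
  show ?thesis
    unfolding E mn(3) by (rule order.trans[OF gradient_square_sum_cone[OF mn(1,2)] n])
qed

lemma potential_kernel_harmonic:
  assumes "x \<noteq> 0"
  shows "laplacian potential_kernel x = 0"
proof -
  obtain m n where mn: "1 \<le> n" "\<bar>m\<bar> \<le> n" "enorm x = enorm (m, n)" "potential_kernel x = potential_kernel (m, n)"
    "\<forall>h :: real \<Rightarrow> real. (\<Sum>y | enorm (x - y) = 1. h (potential_kernel y))
        = (\<Sum>y | enorm ((m, n) - y) = 1. h (potential_kernel y))"
    using cone_representative[OF assms] by (elim exE conjE) (rule that)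
  have "(\<Sum>y | enorm (x - y) = 1. potential_kernel y) = 4 * potential_kernel x"
    unfolding mn(4) neighbour_sum_harmonic[OF mn(1), symmetric] by (rule mn(5)[rule_format])
  moreover have "(\<Sum>y | enorm (x - y) = 1. potential_kernel x) = 4 * potential_kernel x"
    by (cases x) (simp only: sum_neighbours)
  ultimately show ?thesis by (simp add: laplacian_def sum_subtractf)
qed

text \<open>
  Minimum principle: at a zero off the origin harmonicity makes all four neighbours zeros, and by
  connectedness the zero would spread to \<open>(1, 0)\<close>, where the value is \<open>1\<close>.
\<close>

lemma potential_kernel_pos:
  assumes "x \<noteq> 0"
  shows "0 < potential_kernel x"
proof -
  have zero: "potential_kernel y = 0" if "x \<noteq> 0" "enorm (x - y) = 1" "potential_kernel x = 0" for x y
  proof -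
    have "(\<Sum>y | enorm (x - y) = 1. potential_kernel y) = 0"
      using potential_kernel_harmonic[OF that(1)] that(3) by (simp add: laplacian_def sum_negf)
    then have "\<forall>y\<in>{y. enorm (x - y) = 1}. potential_kernel y = 0"
      by (subst sum_nonneg_eq_0_iff[symmetric]) (auto simp: potential_kernel_nonneg)
    then show ?thesis using that(2) by blast
  qed
  have "(potential_kernel x = 0) = (potential_kernel (1, 0) = 0)"
    using zero by (intro constant_off_origin[OF _ assms]) (metis enorm_minus_commute)
  moreover have "potential_kernel (1, 0) = 1"
    by (rule potential_kernel_unit) (simp add: enorm_eq_1_iff steps_def)
  ultimately show ?thesis using potential_kernel_nonneg[of x] by simp
qed

lemma finite_enorm_less: "finite {x. enorm x < R}"
proof (rule finite_subset)
  let ?I = "{- \<lceil>R\<rceil>..\<lceil>R\<rceil>}"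
  show "{x. enorm x < R} \<subseteq> ?I \<times> ?I"
  proof clarify
    fix p q :: int assume r: "enorm (p, q) < R"
    have "\<bar>real_of_int p\<bar> \<le> enorm (p, q)" "\<bar>real_of_int q\<bar> \<le> enorm (p, q)"
      by (rule power2_le_imp_le; simp add: enorm_sq)+
    moreover have "enorm (p, q) \<le> real_of_int \<lceil>R\<rceil>" using r le_of_int_ceiling[of R] by linarith
    ultimately have "real_of_int \<bar>p\<bar> \<le> real_of_int \<lceil>R\<rceil>" "real_of_int \<bar>q\<bar> \<le> real_of_int \<lceil>R\<rceil>"
      unfolding of_int_abs by linarith+
    then show "p \<in> ?I \<and> q \<in> ?I" by (simp only: of_int_le_iff) (simp add: abs_le_iff)
  qed
qed simp

lemma finite_potential_kernel_sublevel: "finite {x. potential_kernel x < S}"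
proof -
  have "filterlim (\<lambda>r. 2 / pi * (ln r + kernel_const) - 84 / r) at_top at_top"
    using pi_gt_zero by real_asymp
  then have "\<forall>\<^sub>F r in at_top. S \<le> 2 / pi * (ln r + kernel_const) - 84 / r"
    by (simp add: filterlim_at_top)
  then obtain R where R: "\<And>r. R \<le> r \<Longrightarrow> S \<le> 2 / pi * (ln r + kernel_const) - 84 / r"
    by (auto simp: eventually_at_top_linorder)
  have "{x. potential_kernel x < S} \<subseteq> insert 0 {x. enorm x < R}"
  proof (intro subsetI)
    fix y assume y: "y \<in> {x. potential_kernel x < S}"
    have contradiction: False if "S \<le> b - c" "\<bar>a - b\<bar> \<le> c" "a < S" for a b c :: real
      using that unfolding abs_le_iff by linarith
    show "y \<in> insert 0 {x. enorm x < R}"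
    proof (rule ccontr)
      assume "\<not> ?thesis"
      then have "y \<noteq> 0" "R \<le> enorm y" by auto
      then show False using contradiction[OF R potential_kernel_asymp] y by blast
    qed
  qed
  then show ?thesis using finite_enorm_less finite_subset by blast
qed

lemma potential_kernel_green_function: "planar_green_function potential_kernel"
  by unfold_locales
    (simp_all add: potential_kernel_origin potential_kernel_pos potential_kernel_unit
      potential_kernel_harmonic finite_potential_kernel_sublevel)

section \<open>The Hardy weight\<close>

text \<open>
  With \<open>r = sqrt (1 + t)\<close> the left-hand side is exactly \<open>(r - 1)\<^sup>3 * (r + 3) / 8\<close> in absolute value,
  so the bound holds down to the end point \<open>t = - 1\<close>.
\<close>

lemma sqrt_taylor_bound:
  assumes "- 1 \<le> t"
  shows "\<bar>1 - sqrt (1 + t) + t / 2 - t\<^sup>2 / 8\<bar> \<le> 3 / 8 * \<bar>t\<bar> ^ 3"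
proof -
  define r where "r = sqrt (1 + t)"
  have r: "0 \<le> r" "t = (r - 1) * (r + 1)" using assms by (simp_all add: r_def algebra_simps)
  have "1 - r + t / 2 - t\<^sup>2 / 8 = - ((r - 1) ^ 3 * (r + 3) / 8)"
    unfolding r(2) by (simp add: power2_eq_square power3_eq_cube field_simps)
  then have "\<bar>1 - r + t / 2 - t\<^sup>2 / 8\<bar> = \<bar>r - 1\<bar> ^ 3 * (r + 3) / 8"
    using r(1) by (simp add: abs_mult power_abs)
  also have "\<dots> \<le> \<bar>r - 1\<bar> ^ 3 * (3 * (r + 1) ^ 3) / 8"
  proof -
    have "r + 3 \<le> 3 * (r + 1) ^ 3" using r(1) by (simp add: power3_eq_cube algebra_simps)
    then show ?thesis by (intro divide_right_mono mult_left_mono) auto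
  qed
  also have "\<dots> = 3 / 8 * \<bar>t\<bar> ^ 3"
    unfolding r(2) using r(1) by (simp add: abs_mult power_mult_distrib)
  finally show ?thesis by (simp add: r_def)
qed

text \<open>
  Apply the Taylor bound to the relative increments \<open>t y = (a y - a x) / a x\<close>. Their sum vanishes by
  harmonicity, and \<open>T\<close> is the sum of their squares, which also bounds the cubes.
\<close>

lemma weight_expansion:
  assumes x: "x \<noteq> 0"
  defines "T \<equiv> gradient_energy x / (potential_kernel x)\<^sup>2"
  shows "\<bar>laplacian (\<lambda>y. sqrt (potential_kernel y)) x / sqrt (potential_kernel x) - T / 8\<bar>
    \<le> 3 / 8 * (T * sqrt T)"
proof -
  define A where "A = potential_kernel x"
  have A: "0 < A" using potential_kernel_pos[OF x] by (simp add: A_def)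
  define t where "t y = (potential_kernel y - A) / A" for y
  let ?N = "{y. enorm (x - y) = 1}"
  have T: "T = (\<Sum>y\<in>?N. (t y)\<^sup>2)"
    by (simp add: T_def gradient_energy_def t_def A_def power_divide sum_divide_distrib)
  have t: "- 1 \<le> t y" for y
    using A potential_kernel_nonneg[of y] by (simp add: t_def field_simps)
  have t_sqrt: "sqrt (1 + t y) = sqrt (potential_kernel y) / sqrt A" for y
    using A by (simp add: t_def real_sqrt_divide[symmetric] field_simps)
  have t_sum: "(\<Sum>y\<in>?N. t y) = 0"
    using potential_kernel_harmonic[OF x]
    by (simp add: t_def A_def laplacian_def sum_divide_distrib[symmetric] sum_subtractf)
  have "laplacian (\<lambda>y. sqrt (potential_kernel y)) x / sqrt A = (\<Sum>y\<in>?N. 1 - sqrt (1 + t y))"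
    using A by (simp add: laplacian_def t_sqrt A_def[symmetric] sum_divide_distrib diff_divide_distrib)
  then have "laplacian (\<lambda>y. sqrt (potential_kernel y)) x / sqrt A - T / 8
      = (\<Sum>y\<in>?N. 1 - sqrt (1 + t y) + t y / 2 - (t y)\<^sup>2 / 8)"
    using t_sum by (simp add: T sum.distrib sum_subtractf sum_divide_distrib[symmetric])
  also have "\<bar>\<dots>\<bar> \<le> (\<Sum>y\<in>?N. 3 / 8 * \<bar>t y\<bar> ^ 3)"
    by (rule order.trans[OF sum_abs]) (intro sum_mono sqrt_taylor_bound t)
  also have "\<dots> \<le> (\<Sum>y\<in>?N. 3 / 8 * (sqrt T * (t y)\<^sup>2))"
  proof (intro sum_mono mult_left_mono)
    fix y assume "y \<in> ?N"
    then have "(t y)\<^sup>2 \<le> T" unfolding T by (intro member_le_sum) auto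
    then have "\<bar>t y\<bar> \<le> sqrt T" by (simp add: real_le_rsqrt)
    then have "\<bar>t y\<bar> * \<bar>t y\<bar>\<^sup>2 \<le> sqrt T * \<bar>t y\<bar>\<^sup>2" by (intro mult_right_mono) auto
    then show "\<bar>t y\<bar> ^ 3 \<le> sqrt T * (t y)\<^sup>2" by (simp add: power3_eq_cube power2_eq_square)
  qed simp
  also have "\<dots> = 3 / 8 * (T * sqrt T)"
    unfolding T[symmetric] sum_distrib_left[symmetric] by simp
  finally show ?thesis by (simp add: A_def)
qed

text \<open>
  Three replacements, each with an error of order \<open>1 / \<bar>x\<bar>\<^sup>3\<close>: the weight by \<open>T / 8\<close>, the squared
  gradient by its leading term, and the kernel in the denominator by its logarithmic asymptotics.
  The hypothesis \<open>large\<close> keeps the kernel and its asymptotic value above \<open>1\<close>. The constant is not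
  optimised.
\<close>

lemma weight_estimate:
  assumes x: "x \<noteq> 0" and r: "1 \<le> enorm x"
    and large: "1 \<le> 2 / pi * (ln (enorm x) + kernel_const) - 84 / enorm x"
  shows "\<bar>laplacian (\<lambda>y. sqrt (potential_kernel y)) x / sqrt (potential_kernel x)
      - 1 / (4 * (enorm x)\<^sup>2 * (ln (enorm x) + kernel_const)\<^sup>2)\<bar> \<le> 10000000 / (enorm x) ^ 3"
proof -
  define r A b E where "r = enorm x" and "A = potential_kernel x"
    and "b = 2 / pi * (ln r + kernel_const)" and "E = gradient_energy x"
  have r1: "1 \<le> r" using r by (simp add: r_def)
  have A: "\<bar>A - b\<bar> \<le> 84 / r" using potential_kernel_asymp[OF x] by (simp add: A_def b_def r_def)
  have A1: "1 \<le> A" and b1: "1 \<le> b"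
    using A large r1 divide_nonneg_nonneg[of 84 r] unfolding b_def[symmetric] r_def[symmetric] by linarith+
  have E: "\<bar>E - 8 / pi\<^sup>2 / r\<^sup>2\<bar> \<le> 11200 / r ^ 3" using gradient_energy_asymp[OF x] by (simp add: E_def r_def)
  have E0: "0 \<le> E" by (auto simp: E_def gradient_energy_def intro: sum_nonneg)
  have pi8: "8 / pi\<^sup>2 \<le> 1" using mult_mono[of 3 pi 3 pi] pi_gt3 by (simp add: power2_eq_square divide_le_eq_1)
  have E_le: "E \<le> 11201 / r\<^sup>2"
  proof -
    have "11200 / r ^ 3 \<le> 11200 / r\<^sup>2" using r1 by (intro divide_left_mono power_increasing) auto
    moreover have "8 / pi\<^sup>2 / r\<^sup>2 \<le> 1 / r\<^sup>2" using pi8 by (intro divide_right_mono) auto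
    moreover have "11200 / r\<^sup>2 + 1 / r\<^sup>2 = 11201 / r\<^sup>2" by (simp add: add_divide_distrib[symmetric])
    ultimately show ?thesis using E by linarith
  qed
  define T where "T = E / A\<^sup>2"
  have T: "0 \<le> T" "T \<le> 11201 / r\<^sup>2"
  proof -
    show "0 \<le> T" using E0 by (simp add: T_def)
    have "T \<le> E / 1" unfolding T_def using E0 A1 by (intro divide_left_mono) (auto simp: one_le_power)
    then show "T \<le> 11201 / r\<^sup>2" using E_le by simp
  qed
  \<comment> \<open>106 is an integer whose square exceeds 11201.\<close>
  have "sqrt T \<le> 106 / r"
  proof -
    have "T \<le> (106 / r)\<^sup>2" using T(2) r1 by (simp add: power_divide divide_right_mono order.trans)
    then show ?thesis using r1 by (intro real_le_lsqrt) auto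
  qed
  then have "T * sqrt T \<le> 11201 / r\<^sup>2 * (106 / r)" using T by (intro mult_mono) auto
  also have "\<dots> = 1187306 / r ^ 3" by (simp add: power2_eq_square power3_eq_cube)
  finally have step1: "\<bar>laplacian (\<lambda>y. sqrt (potential_kernel y)) x / sqrt A - T / 8\<bar> \<le> 3 / 8 * (1187306 / r ^ 3)"
    using weight_expansion[OF x] unfolding T_def E_def A_def by (auto intro: order.trans)
  have step2: "\<bar>T / 8 - 1 / (pi\<^sup>2 * r\<^sup>2 * A\<^sup>2)\<bar> \<le> 1400 * (1 / r ^ 3)"
  proof -
    have "T / 8 - 1 / (pi\<^sup>2 * r\<^sup>2 * A\<^sup>2) = (E - 8 / pi\<^sup>2 / r\<^sup>2) / (8 * A\<^sup>2)"
      by (simp add: T_def diff_divide_distrib)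
    then have "\<bar>T / 8 - 1 / (pi\<^sup>2 * r\<^sup>2 * A\<^sup>2)\<bar> = \<bar>E - 8 / pi\<^sup>2 / r\<^sup>2\<bar> / (8 * A\<^sup>2)"
      by (simp add: abs_divide)
    also have "\<dots> \<le> (11200 / r ^ 3) / (8 * 1)"
      using E A1 r1 by (intro frac_le mult_left_mono) (auto simp: one_le_power)
    finally show ?thesis by simp
  qed
  have step3: "\<bar>1 / (pi\<^sup>2 * r\<^sup>2 * A\<^sup>2) - 1 / (4 * r\<^sup>2 * (ln r + kernel_const)\<^sup>2)\<bar> \<le> 168 * (1 / r ^ 3)"
  proof -
    have "1 / (4 * r\<^sup>2 * (ln r + kernel_const)\<^sup>2) = 1 / (pi\<^sup>2 * r\<^sup>2 * b\<^sup>2)"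
    proof -
      have "pi\<^sup>2 * b\<^sup>2 = 4 * (ln r + kernel_const)\<^sup>2"
        unfolding b_def power_mult_distrib power_divide by simp
      then have "4 * r\<^sup>2 * (ln r + kernel_const)\<^sup>2 = pi\<^sup>2 * r\<^sup>2 * b\<^sup>2"
        by (metis mult.assoc mult.commute)
      then show ?thesis by (simp only:)
    qed
    moreover have "1 / (pi\<^sup>2 * r\<^sup>2 * A\<^sup>2) - 1 / (pi\<^sup>2 * r\<^sup>2 * b\<^sup>2)
        = (1 / (pi\<^sup>2 * r\<^sup>2)) * ((b - A) * (1 / (A\<^sup>2 * b) + 1 / (A * b\<^sup>2)))"
      using A1 b1 r1 by (simp add: field_simps power2_eq_square)
    moreover have "\<bar>(1 / (pi\<^sup>2 * r\<^sup>2)) * ((b - A) * (1 / (A\<^sup>2 * b) + 1 / (A * b\<^sup>2)))\<bar> \<le> (1 / (1 * r\<^sup>2)) * (84 / r * (1 + 1))"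
      unfolding abs_mult
    proof (intro mult_mono)
      have "1 \<le> pi\<^sup>2" using pi_gt3 by (intro one_le_power) auto
      then show "\<bar>1 / (pi\<^sup>2 * r\<^sup>2)\<bar> \<le> 1 / (1 * r\<^sup>2)"
        using r1 unfolding abs_divide by (intro frac_le) (auto intro!: mult_right_mono)
      show "\<bar>b - A\<bar> \<le> 84 / r" using A by (simp add: abs_minus_commute)
      have "1 \<le> A\<^sup>2 * b" "1 \<le> A * b\<^sup>2"
        using A1 b1 mult_mono[of 1 "A\<^sup>2" 1 b] mult_mono[of 1 A 1 "b\<^sup>2"] by (auto simp: one_le_power)
      then have "1 / (A\<^sup>2 * b) \<le> 1" "1 / (A * b\<^sup>2) \<le> 1" "0 \<le> 1 / (A\<^sup>2 * b)" "0 \<le> 1 / (A * b\<^sup>2)"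
        by (auto simp: divide_le_eq_1)
      then show "\<bar>1 / (A\<^sup>2 * b) + 1 / (A * b\<^sup>2)\<bar> \<le> 1 + 1" by linarith
    qed (use r1 in auto)
    moreover have "(1 / (1 * r\<^sup>2)) * (84 / r * (1 + 1)) = 168 * (1 / r ^ 3)"
      by (simp add: power2_eq_square power3_eq_cube)
    ultimately show ?thesis by (simp only:)
  qed
  have final: "\<bar>w - v\<bar> \<le> 10000000 * c"
    if "\<bar>w - p\<bar> \<le> 3 / 8 * (1187306 * c)" "\<bar>p - q\<bar> \<le> 1400 * c" "\<bar>q - v\<bar> \<le> 168 * c" "0 \<le> c"
    for w p q v c :: real
    using that unfolding abs_le_iff by linarith
  have "\<bar>laplacian (\<lambda>y. sqrt (potential_kernel y)) x / sqrt A - 1 / (4 * r\<^sup>2 * (ln r + kernel_const)\<^sup>2)\<bar>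
      \<le> 10000000 * (1 / r ^ 3)"
    using step1 r1 by (intro final[OF _ step2 step3]) auto
  then show ?thesis by (simp add: A_def r_def)
qed

text \<open>
  The error \<open>1 / \<bar>x\<bar>\<^sup>3\<close> is far below the claimed order, so only the expansion of
  \<open>1 / (ln \<bar>x\<bar> + kernel_const)\<^sup>2\<close> in powers of \<open>1 / ln \<bar>x\<bar>\<close> remains.
\<close>

lemma weight_asymptotics:
  fixes w :: "lattice \<Rightarrow> real"
  assumes w: "\<And>x. x \<noteq> 0 \<Longrightarrow> w x = laplacian (\<lambda>y. sqrt (potential_kernel y)) x / sqrt (potential_kernel x)"
  shows "(\<lambda>x. w x - (1/4 * (1 / ((enorm x)\<^sup>2 * (ln (enorm x))\<^sup>2))
                - (ln 8 + 2 * euler_mascheroni) / 4 * (1 / ((enorm x)\<^sup>2 * (ln (enorm x)) ^ 3))))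
      \<in> O[filtercomap enorm at_top](\<lambda>x. 1 / ((enorm x)\<^sup>2 * (ln (enorm x)) ^ 4))"
proof -
  let ?main = "\<lambda>r. 1 / (4 * r\<^sup>2 * (ln r + kernel_const)\<^sup>2)"
  let ?g = "\<lambda>r :: real. 1 / (r\<^sup>2 * (ln r) ^ 4)"
  have "\<forall>\<^sub>F r in at_top. 1 \<le> r \<and> 1 \<le> 2 / pi * (ln r + kernel_const) - 84 / r"
  proof (intro eventually_conj eventually_ge_at_top)
    have "filterlim (\<lambda>r. 2 / pi * (ln r + kernel_const) - 84 / r) at_top at_top"
      using pi_gt_zero by real_asymp
    then show "\<forall>\<^sub>F r in at_top. 1 \<le> 2 / pi * (ln r + kernel_const) - 84 / r"
      by (simp add: filterlim_at_top)
  qed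
  then have "\<forall>\<^sub>F x in filtercomap enorm at_top.
      1 \<le> enorm x \<and> 1 \<le> 2 / pi * (ln (enorm x) + kernel_const) - 84 / enorm x"
    by (rule eventually_filtercomapI)
  then have "\<forall>\<^sub>F x in filtercomap enorm at_top. norm (w x - ?main (enorm x)) \<le> 10000000 * norm (1 / (enorm x) ^ 3)"
  proof eventually_elim
    case (elim x)
    then have "x \<noteq> 0" by (auto simp: enorm_def real_point_def zero_prod_def)
    then show ?case using weight_estimate[of x] elim w[of x] by simp
  qed
  then have "(\<lambda>x. w x - ?main (enorm x)) \<in> O[filtercomap enorm at_top](\<lambda>x. 1 / (enorm x) ^ 3)"
    by (rule bigoI)
  also have "(\<lambda>x. 1 / (enorm x) ^ 3) \<in> O[filtercomap enorm at_top](\<lambda>x. ?g (enorm x))"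
  proof (rule landau_o.big.filtercomap)
    show "(\<lambda>r. 1 / r ^ 3) \<in> O[at_top](?g)" by real_asymp
  qed
  finally have 1: "(\<lambda>x. w x - ?main (enorm x)) \<in> O[filtercomap enorm at_top](\<lambda>x. ?g (enorm x))" .
  have 2: "(\<lambda>x. ?main (enorm x) - (1/4 * (1 / ((enorm x)\<^sup>2 * (ln (enorm x))\<^sup>2))
                - (2 * kernel_const) / 4 * (1 / ((enorm x)\<^sup>2 * (ln (enorm x)) ^ 3))))
      \<in> O[filtercomap enorm at_top](\<lambda>x. ?g (enorm x))"
  proof (rule landau_o.big.filtercomap)
    show "(\<lambda>r. ?main r - (1/4 * (1 / (r\<^sup>2 * (ln r)\<^sup>2)) - (2 * kernel_const) / 4 * (1 / (r\<^sup>2 * (ln r) ^ 3))))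
      \<in> O[at_top](?g)"
      by real_asymp
  qed
  have c: "ln 8 + 2 * euler_mascheroni = 2 * kernel_const" by (simp add: kernel_const_def)
  show ?thesis
    unfolding c using sum_in_bigo(1)[OF 1 2] by (simp only: add_diff_eq diff_add_cancel)
qed

theorem corollary2:
  fixes w :: "lattice \<Rightarrow> real"
  assumes "\<And>x. x \<in> - {0} \<Longrightarrow>
    w x = laplacian (\<lambda>y. sqrt (potential_kernel y)) x / sqrt (potential_kernel x)"
  shows "null_critical_hardy_weight (- {0}) w \<and>
    (\<lambda>x. w x - (1/4 * (1 / ((enorm x)\<^sup>2 * (ln (enorm x))\<^sup>2))
                - (ln 8 + 2 * euler_mascheroni) / 4 * (1 / ((enorm x)\<^sup>2 * (ln (enorm x)) ^ 3))))
      \<in> O[filtercomap enorm at_top](\<lambda>x. 1 / ((enorm x)\<^sup>2 * (ln (enorm x)) ^ 4))"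
proof
  have w: "\<And>x. x \<noteq> 0 \<Longrightarrow> w x = laplacian (\<lambda>y. sqrt (potential_kernel y)) x / sqrt (potential_kernel x)"
    by (rule assms) (simp only: Compl_iff singleton_iff not_False_eq_True)
  show "null_critical_hardy_weight (- {0}) w"
  proof (rule square_root_weight.null_critical[where a = potential_kernel])
    show "square_root_weight potential_kernel w"
      by (rule square_root_weight.intro[OF potential_kernel_green_function], rule square_root_weight_axioms.intro, rule w)
  qed
  show "(\<lambda>x. w x - (1/4 * (1 / ((enorm x)\<^sup>2 * (ln (enorm x))\<^sup>2))
                - (ln 8 + 2 * euler_mascheroni) / 4 * (1 / ((enorm x)\<^sup>2 * (ln (enorm x)) ^ 3))))
      \<in> O[filtercomap enorm at_top](\<lambda>x. 1 / ((enorm x)\<^sup>2 * (ln (enorm x)) ^ 4))"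
    by (rule weight_asymptotics) (rule w)
qed

end
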